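(* Let $G_f\in V_1$, $G_b\in E_1$ and $(\partial_z G_f;\partial_z G_b)\in [L_6(\mathcal{O})]^3$. Let $(S_t,W_1)$ be the dynamical system generated by the viscous primitive equations (PE) with periodic boundary conditions (described in the context), and let $\mathscr{D}$ be its forward invariant absorbing set contained in an absorbing ball $\{U\in W_2:\|U\|_{W_2}\le R_*\}$. Let $N$ be such that for some $T>0$ and $0<q<1$ $$\|Q_N[S_TU-S_TU_*]\|_{W_1}\le q\|U-U_*\|_{W_1}\quad\text{for all } U,U_*\in\mathscr{D}.$$ Then $(S_t,W_1)$ possesses $N$ determining modes; that is, whenever $U,U_*\in W_1$ satisfy $$\lim_{t\to+\infty}\|P_N[S_tU-S_tU_*]\|_{W_1}=0,$$ one has $\|S_tU-S_tU_*\|_{W_1}\to0$ as $t\to+\infty$.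
   Context: Domain and notation. $\mathcal{O}=(0,L_1)\times(0,L_2)\times(-L_3/2,L_3/2)\subset\mathbb{R}^3$ with $L_1,L_2,L_3>0$; points are $\bar x=(x,z)$, $x=(x_1,x_2)$. The symbols $\nabla$, $\mathrm{div}$, $\Delta$ denote gradient, divergence and Laplacian in the two-dimensional variable $x$; $\nabla_{x,z}$, $\Delta_{x,z}$ are the three-dimensional ones. For $v=(v^1;v^2)$, $v^\perp=(-v^2;v^1)$. The viscosity $\nu>0$, the Coriolis parameter $f\in\mathbb{R}$ (constant) and the time-independent sources $G_f=G_f(\bar x)\in\mathbb{R}^2$, $G_b=G_b(\bar x)\in\mathbb{R}$ are given. System (PE). The unknowns are $v=(v^1;v^2)(\bar x,t)$, $b=b(\bar x,t)$ and the pressure $p=p(x,t)$ (independent of $z$): $$v_t+(v,\nabla)v-\Big[\int_0^z\mathrm{div}\,v\,d\xi\Big]\partial_zv-\nu[\Delta v+\partial_{zz}v]+fv^\perp=-\nabla\Big[p(x,t)+\int_0^z b\,d\xi\Big]+G_f,$$ $$b_t+(v,\nabla)b-\Big[\int_0^z\mathrm{div}\,v\,d\xi\Big]\partial_zb-\nu[\Delta b+\partial_{zz}b]=G_b$$ in $\mathcal{O}\times(0,\infty)$, with: $v$ periodic in $\bar x$ and even in $z$, $\mathrm{div}\int_{-L_3/2}^{L_3/2}v\,dz=0$, $\int_{\mathcal{O}}v\,d\bar x=0$; $b$ periodic in $\bar x$ and odd in $z$; and initial data $v(0)=v_0$, $b(0)=b_0$. Spaces. $\dot H^s_{per}(\mathcal{O})$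 is the Sobolev space of order $s$ of periodic functions with zero integral over $\mathcal{O}$. For $s=0,1,2$: $V_s=\{v=(v^1;v^2)\in[\dot H^s_{per}(\mathcal{O})]^2: v^i \text{ even in } z,\ \mathrm{div}\int_{-L_3/2}^{L_3/2}v\,dz=0\}$, with norms $\|\cdot\|=\|\cdot\|_{L_2}$ on $V_0$, $\|v\|_{V_1}=\|\nabla_{x,z}v\|$, $\|v\|_{V_2}=\|\Delta_{x,z}v\|$; $E_s=\{b\in\dot H^s_{per}(\mathcal{O}): b\text{ odd in }z\}$ with the standard norms; $W_s=V_s\times E_s$ with the Euclidean product norm. Dynamical system. It is known that for $G_f\in V_0$, $G_b\in E_0$ and every $U_0=(v_0;b_0)\in W_1$, (PE) has a unique strong solution $U(t;U_0)=(v(t);b(t))\in C(\mathbb{R}_+;W_1)\cap L_2(0,T;W_2)$ for all $T>0$, depending continuously on $t$ and $U_0$. The evolution operator is $S_tU_0=U(t;U_0)$, $t\ge0$, on $W_1$. Absorbing sets. A set $K$ is absorbing if for every bounded $B\subset W_1$ there is $t_B$ with $S_tB\subset K$ for all $t\ge t_B$; $\mathscr{D}$ is forward invariant if $S_t\mathscr{D}\subset\mathscr{D}$ for all $t\ge0$. Under the stated hypotheses on $G_f,G_b$ there is $R_*>0$ such that the ball $\{U\in W_2:\|U\|_{W_2}\le R_*\}$ is absorbing and contains a forward invariant absorbing set $\mathscr{D}$. Projectors. On $W_1$ consider the bilinear form $a(U,U_* )=\int_{\mathcal{O}}[\nabla_{x,z}v\cdot\nabla_{x,z}v_*+\nabla_{x,z}b\cdot\nabla_{x,z}b_*]\,dx\,dz$,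 $U=(v;b)$, $U_*=(v_*;b_* )$. It generates a positive self-adjoint operator $A$ in $W_0$ with discrete spectrum: $Ae_k=\lambda_ke_k$, $0<\lambda_1\le\lambda_2\le\dots$, $\lambda_k\to+\infty$, with $\{e_k\}$ an orthonormal basis of $W_0$. $P_N$ is the orthoprojector onto $\mathrm{Span}\{e_1,\dots,e_N\}$ and $Q_N=I-P_N$. *)

theory Defs
  imports "HOL-Analysis.Analysis"
begin

text \<open>
  A point of \<open>real^3\<close> is \<open>(x, z)\<close> with \<open>x = (x$1, x$2)\<close> and \<open>z = x$3\<close>; the periods are
  \<open>L$1, L$2, L$3\<close>. Elements of Lebesgue and Sobolev spaces are represented by Borel functions
  on the whole space; norms, derivatives and membership are invariant under Borel changes on null
  sets, and equality
  of such elements is equality almost everywhere.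
\<close>

definition cell :: "real^3 \<Rightarrow> (real^3) set" where
  "cell L = {x. 0 < x$1 \<and> x$1 < L$1 \<and> 0 < x$2 \<and> x$2 < L$2 \<and> - (L$3/2) < x$3 \<and> x$3 < L$3/2}"

definition Lp_cell :: "real^3 \<Rightarrow> nat \<Rightarrow> (real^3 \<Rightarrow> 'a::euclidean_space) set" where
  "Lp_cell L p = {u \<in> borel_measurable borel. set_integrable lborel (cell L) (\<lambda>x. norm (u x) ^ p)}"

definition L2_per :: "real^3 \<Rightarrow> (real^3 \<Rightarrow> 'a::euclidean_space) set" where
  "L2_per L = {u \<in> Lp_cell L 2. AE x in lborel. \<forall>i. u (x + axis i (L$i)) = u x}"

definition L2_norm :: "real^3 \<Rightarrow> (real^3 \<Rightarrow> 'a::euclidean_space) \<Rightarrow> real" where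
  "L2_norm L u = sqrt (LINT x:cell L|lborel. (norm (u x))\<^sup>2)"

definition L2_inner :: "real^3 \<Rightarrow> (real^3 \<Rightarrow> 'a::euclidean_space) \<Rightarrow> (real^3 \<Rightarrow> 'a) \<Rightarrow> real" where
  "L2_inner L u w = (LINT x:cell L|lborel. u x \<bullet> w x)"


section \<open>Weak derivatives and periodic Sobolev spaces\<close>

definition classical_partial :: "3 \<Rightarrow> (real^3 \<Rightarrow> real) \<Rightarrow> real^3 \<Rightarrow> real" where
  "classical_partial i \<phi> x = frechet_derivative \<phi> (at x) (axis i 1)"

text \<open>Infinitely differentiable: all iterated partial derivatives are differentiable everywhere.\<close>

definition smooth :: "(real^3 \<Rightarrow> real) \<Rightarrow> bool" where
  "smooth \<phi> \<longleftrightarrow> (\<forall>is x. foldr classical_partial is \<phi> differentiable (at x))"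

definition test_per :: "real^3 \<Rightarrow> (real^3 \<Rightarrow> real) set" where
  "test_per L = {\<phi>. smooth \<phi> \<and> (\<forall>x i. \<phi> (x + axis i (L$i)) = \<phi> x)}"

definition has_weak_partial ::
    "real^3 \<Rightarrow> 3 \<Rightarrow> (real^3 \<Rightarrow> 'a::euclidean_space) \<Rightarrow> (real^3 \<Rightarrow> 'a) \<Rightarrow> bool" where
  "has_weak_partial L i u g \<longleftrightarrow> u \<in> L2_per L \<and> g \<in> L2_per L \<and>
     (\<forall>\<phi>\<in>test_per L. (LINT x:cell L|lborel. classical_partial i \<phi> x *\<^sub>R u x)
                     = - (LINT x:cell L|lborel. \<phi> x *\<^sub>R g x))"

text \<open>
  The square-integrable weak partial derivative; if it exists it is unique up to null sets.
  If it does not exist, \<open>wpartial\<close> is an arbitrary function, so uses below go together with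
  membership in a Sobolev space.
\<close>

definition wpartial :: "real^3 \<Rightarrow> 3 \<Rightarrow> (real^3 \<Rightarrow> 'a::euclidean_space) \<Rightarrow> real^3 \<Rightarrow> 'a" where
  "wpartial L i u = (SOME g. has_weak_partial L i u g)"

primrec H_per :: "real^3 \<Rightarrow> nat \<Rightarrow> (real^3 \<Rightarrow> 'a::euclidean_space) set" where
  "H_per L 0 = L2_per L"
| "H_per L (Suc s) = {u \<in> L2_per L. \<forall>i. \<exists>g\<in>H_per L s. has_weak_partial L i u g}"

definition Hdot_per :: "real^3 \<Rightarrow> nat \<Rightarrow> (real^3 \<Rightarrow> 'a::euclidean_space) set" where
  "Hdot_per L s = {u \<in> H_per L s. (LINT x:cell L|lborel. u x) = 0}"

definition laplacian3 :: "real^3 \<Rightarrow> (real^3 \<Rightarrow> 'a::euclidean_space) \<Rightarrow> real^3 \<Rightarrow> 'a" where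
  "laplacian3 L u x = (\<Sum>i\<in>UNIV. wpartial L i (wpartial L i u) x)"

text \<open>The norms on the zero-mean spaces of order 0, 1 and 2; other orders are not used.\<close>

definition Hdot_norm :: "real^3 \<Rightarrow> nat \<Rightarrow> (real^3 \<Rightarrow> 'a::euclidean_space) \<Rightarrow> real" where
  "Hdot_norm L s u =
     (if s = 0 then L2_norm L u
      else if s = 1 then sqrt (\<Sum>i\<in>UNIV. (L2_norm L (wpartial L i u))\<^sup>2)
      else L2_norm L (laplacian3 L u))"


section \<open>Horizontal and vertical operations\<close>

definition horizontal :: "real^3 \<Rightarrow> real^2" where
  "horizontal x = vector [x$1, x$2]"

definition at_height :: "real^3 \<Rightarrow> real \<Rightarrow> real^3" where
  "at_height x z = vector [x$1, x$2, z]"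

text \<open>
  The integral from \<open>0\<close> to \<open>z\<close>; for negative \<open>z\<close> the interval integral carries the
  orientation sign.
\<close>

definition vint :: "(real^3 \<Rightarrow> 'a::euclidean_space) \<Rightarrow> real^3 \<Rightarrow> 'a" where
  "vint g x = (LBINT \<xi>=0..ereal (x$3). g (at_height x \<xi>))"

definition column_integral :: "real^3 \<Rightarrow> (real^3 \<Rightarrow> 'a::euclidean_space) \<Rightarrow> real^3 \<Rightarrow> 'a" where
  "column_integral L g x = (LBINT \<xi>=ereal (- (L$3/2))..ereal (L$3/2). g (at_height x \<xi>))"

text \<open>
  Vanishing horizontal divergence in the sense of distributions, as needed for fields that
  are only square integrable.
\<close>

definition weakly_hdiv_free :: "real^3 \<Rightarrow> (real^3 \<Rightarrow> real^2) \<Rightarrow> bool" where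
  "weakly_hdiv_free L w \<longleftrightarrow> (\<forall>\<phi>\<in>test_per L.
     (LINT x:cell L|lborel. w x $ 1 * classical_partial 1 \<phi> x + w x $ 2 * classical_partial 2 \<phi> x) = 0)"

definition hdiv :: "real^3 \<Rightarrow> (real^3 \<Rightarrow> real^2) \<Rightarrow> real^3 \<Rightarrow> real" where
  "hdiv L v x = wpartial L 1 v x $ 1 + wpartial L 2 v x $ 2"

definition hgrad :: "real^3 \<Rightarrow> (real^3 \<Rightarrow> real) \<Rightarrow> real^3 \<Rightarrow> real^2" where
  "hgrad L q x = vector [wpartial L 1 q x, wpartial L 2 q x]"

definition hlaplacian :: "real^3 \<Rightarrow> (real^3 \<Rightarrow> 'a::euclidean_space) \<Rightarrow> real^3 \<Rightarrow> 'a" where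
  "hlaplacian L u x = wpartial L 1 (wpartial L 1 u) x + wpartial L 2 (wpartial L 2 u) x"

definition hadvect ::
    "real^3 \<Rightarrow> (real^3 \<Rightarrow> real^2) \<Rightarrow> (real^3 \<Rightarrow> 'a::euclidean_space) \<Rightarrow> real^3 \<Rightarrow> 'a" where
  "hadvect L v u x = v x $ 1 *\<^sub>R wpartial L 1 u x + v x $ 2 *\<^sub>R wpartial L 2 u x"

definition perp :: "real^2 \<Rightarrow> real^2" where
  "perp a = vector [- (a$2), a$1]"


section \<open>Phase spaces\<close>

definition z_reflect :: "real^3 \<Rightarrow> real^3" where
  "z_reflect x = at_height x (- (x$3))"

definition V_space :: "real^3 \<Rightarrow> nat \<Rightarrow> (real^3 \<Rightarrow> real^2) set" where
  "V_space L s = {v \<in> Hdot_per L s. (AE x in lborel. v (z_reflect x) = v x) \<and>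
                                    weakly_hdiv_free L (column_integral L v)}"

definition E_space :: "real^3 \<Rightarrow> nat \<Rightarrow> (real^3 \<Rightarrow> real) set" where
  "E_space L s = {b \<in> Hdot_per L s. AE x in lborel. b (z_reflect x) = - b x}"

text \<open>The pair \<open>U = (v; b)\<close> is a single function with \<open>v = fst \<circ> U\<close> and \<open>b = snd \<circ> U\<close>.\<close>

type_synonym pe_state = "real^3 \<Rightarrow> (real^2) \<times> real"

definition W_space :: "real^3 \<Rightarrow> nat \<Rightarrow> pe_state set" where
  "W_space L s = {U. fst \<circ> U \<in> V_space L s \<and> snd \<circ> U \<in> E_space L s}"

definition W_norm :: "real^3 \<Rightarrow> nat \<Rightarrow> pe_state \<Rightarrow> real" where
  "W_norm L s U = sqrt ((Hdot_norm L s (fst \<circ> U))\<^sup>2 + (Hdot_norm L s (snd \<circ> U))\<^sup>2)"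


section \<open>Strong solutions of the primitive equations\<close>

definition momentum_equation ::
    "real^3 \<Rightarrow> real \<Rightarrow> real \<Rightarrow> (real^3 \<Rightarrow> real^2) \<Rightarrow>
     (real^3 \<Rightarrow> real^2) \<Rightarrow> (real^3 \<Rightarrow> real^2) \<Rightarrow> (real^3 \<Rightarrow> real) \<Rightarrow> (real^2 \<Rightarrow> real) \<Rightarrow> real^3 \<Rightarrow> bool" where
  "momentum_equation L \<nu> f Gf vt v b p x \<longleftrightarrow>
     vt x + hadvect L v v x - vint (hdiv L v) x *\<^sub>R wpartial L 3 v x
       - \<nu> *\<^sub>R (hlaplacian L v x + wpartial L 3 (wpartial L 3 v) x) + f *\<^sub>R perp (v x)
     = - hgrad L (\<lambda>y. p (horizontal y) + vint b y) x + Gf x"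

definition buoyancy_equation ::
    "real^3 \<Rightarrow> real \<Rightarrow> (real^3 \<Rightarrow> real) \<Rightarrow>
     (real^3 \<Rightarrow> real) \<Rightarrow> (real^3 \<Rightarrow> real^2) \<Rightarrow> (real^3 \<Rightarrow> real) \<Rightarrow> real^3 \<Rightarrow> bool" where
  "buoyancy_equation L \<nu> Gb bt v b x \<longleftrightarrow>
     bt x + hadvect L v b x - vint (hdiv L v) x * wpartial L 3 b x
       - \<nu> * (hlaplacian L b x + wpartial L 3 (wpartial L 3 b) x)
     = Gb x"

text \<open>
  \<open>dU\<close> is the time derivative of \<open>U\<close>, locally square integrable in time with values in
  the square-integrable functions, in the sense of absolutely continuous functions with values
  in that space: \<open>U t - U s\<close> is the integral of \<open>dU\<close> over \<open>[s, t]\<close>.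
\<close>

definition has_time_derivative :: "real^3 \<Rightarrow> (real \<Rightarrow> pe_state) \<Rightarrow> (real \<Rightarrow> pe_state) \<Rightarrow> bool" where
  "has_time_derivative L U dU \<longleftrightarrow>
     (\<lambda>(t, x). dU t x) \<in> borel_measurable borel \<and>
     (\<forall>T>0. set_integrable lborel ({0..T} \<times> cell L) (\<lambda>(t, x). (norm (dU t x))\<^sup>2)) \<and>
     (\<forall>s t. 0 \<le> s \<and> s \<le> t \<longrightarrow>
        (AE x\<in>cell L in lborel. U t x - U s x = (LINT \<tau>:{s..t}|lborel. dU \<tau> x)))"

text \<open>
  Strong solutions lie in \<open>C([0,\<infinity>); W\<^sub>1)\<close> and \<open>L\<^sub>2(0, T; W\<^sub>2)\<close> for all \<open>T > 0\<close> and satisfy the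
  equations almost everywhere. Periodicity, parity, zero mean and the divergence constraint are
  part of membership in \<open>W\<^sub>1\<close>. The pressure is periodic and square integrable with its gradient.
\<close>

definition strong_solution ::
    "real^3 \<Rightarrow> real \<Rightarrow> real \<Rightarrow> (real^3 \<Rightarrow> real^2) \<Rightarrow> (real^3 \<Rightarrow> real) \<Rightarrow> pe_state \<Rightarrow> (real \<Rightarrow> pe_state) \<Rightarrow> bool"
  where
  "strong_solution L \<nu> f Gf Gb U0 U \<longleftrightarrow>
     (\<forall>t\<ge>0. U t \<in> W_space L 1) \<and>
     (\<forall>s\<ge>0. ((\<lambda>t. W_norm L 1 (U t - U s)) \<longlongrightarrow> 0) (at s within {0..})) \<and>
     (AE t\<in>{0<..} in lborel. U t \<in> W_space L 2) \<and>
     (\<forall>T>0. (\<lambda>t. (W_norm L 2 (U t))\<^sup>2) absolutely_integrable_on {0..T}) \<and>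
     (AE x\<in>cell L in lborel. U 0 x = U0 x) \<and>
     (\<exists>dU p. has_time_derivative L U dU \<and>
        (AE t\<in>{0<..} in lborel.
           (\<lambda>y. p t (horizontal y)) \<in> H_per L 1 \<and>
           (AE x\<in>cell L in lborel.
              momentum_equation L \<nu> f Gf (fst \<circ> dU t) (fst \<circ> U t) (snd \<circ> U t) (p t) x \<and>
              buoyancy_equation L \<nu> Gb (snd \<circ> dU t) (fst \<circ> U t) (snd \<circ> U t) x)))"


section \<open>The dynamical system\<close>

definition PE_dynamical_system ::
    "real^3 \<Rightarrow> real \<Rightarrow> real \<Rightarrow> (real^3 \<Rightarrow> real^2) \<Rightarrow> (real^3 \<Rightarrow> real) \<Rightarrow> (real \<Rightarrow> pe_state \<Rightarrow> pe_state) \<Rightarrow> bool"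
  where
  "PE_dynamical_system L \<nu> f Gf Gb S \<longleftrightarrow>
     (\<forall>U0\<in>W_space L 1.
        strong_solution L \<nu> f Gf Gb U0 (\<lambda>t. S t U0) \<and>
        (\<forall>U. strong_solution L \<nu> f Gf Gb U0 U \<longrightarrow>
             (\<forall>t\<ge>0. AE x\<in>cell L in lborel. U t x = S t U0 x))) \<and>
     (\<forall>t\<ge>0. \<forall>U0\<in>W_space L 1. \<forall>\<epsilon>>0. \<exists>\<delta>>0. \<forall>U1\<in>W_space L 1.
        W_norm L 1 (U1 - U0) < \<delta> \<longrightarrow> W_norm L 1 (S t U1 - S t U0) < \<epsilon>)"

definition absorbing :: "real^3 \<Rightarrow> (real \<Rightarrow> pe_state \<Rightarrow> pe_state) \<Rightarrow> pe_state set \<Rightarrow> bool" where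
  "absorbing L S K \<longleftrightarrow>
     (\<forall>B. B \<subseteq> W_space L 1 \<and> (\<exists>r. \<forall>U\<in>B. W_norm L 1 U \<le> r) \<longrightarrow>
          (\<exists>tB\<ge>0. \<forall>t\<ge>tB. S t ` B \<subseteq> K))"

definition forward_invariant :: "(real \<Rightarrow> pe_state \<Rightarrow> pe_state) \<Rightarrow> pe_state set \<Rightarrow> bool" where
  "forward_invariant S K \<longleftrightarrow> (\<forall>t\<ge>0. S t ` K \<subseteq> K)"

definition W2_ball :: "real^3 \<Rightarrow> real \<Rightarrow> pe_state set" where
  "W2_ball L R = {U \<in> W_space L 2. W_norm L 2 U \<le> R}"


section \<open>Spectral projectors and determining modes\<close>

definition dirichlet_form :: "real^3 \<Rightarrow> pe_state \<Rightarrow> pe_state \<Rightarrow> real" where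
  "dirichlet_form L U W = (LINT x:cell L|lborel.
     (\<Sum>i\<in>UNIV. wpartial L i (fst \<circ> U) x \<bullet> wpartial L i (fst \<circ> W) x) +
     (\<Sum>i\<in>UNIV. wpartial L i (snd \<circ> U) x * wpartial L i (snd \<circ> W) x))"

text \<open>The graph of the self-adjoint operator in \<open>W\<^sub>0\<close> generated by the form on \<open>W\<^sub>1\<close>.\<close>

definition form_operator :: "real^3 \<Rightarrow> (pe_state \<times> pe_state) set" where
  "form_operator L = {(U, F). U \<in> W_space L 1 \<and> F \<in> W_space L 0 \<and>
     (\<forall>W\<in>W_space L 1. dirichlet_form L U W = L2_inner L F W)}"

text \<open>The orthoprojector in \<open>W\<^sub>0\<close> onto the span of the first \<open>N\<close> modes, for orthonormal \<open>e\<close>.\<close>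

definition P_proj :: "real^3 \<Rightarrow> (nat \<Rightarrow> pe_state) \<Rightarrow> nat \<Rightarrow> pe_state \<Rightarrow> pe_state" where
  "P_proj L e N U = (\<lambda>x. \<Sum>k<N. L2_inner L U (e k) *\<^sub>R e k x)"

definition Q_proj :: "real^3 \<Rightarrow> (nat \<Rightarrow> pe_state) \<Rightarrow> nat \<Rightarrow> pe_state \<Rightarrow> pe_state" where
  "Q_proj L e N U = U - P_proj L e N U"

text \<open>
  Indices start at \<open>0\<close>, so that \<open>e k\<close> and \<open>lam k\<close> are the mathematical \<open>e\<^sub>k\<^sub>+\<^sub>1\<close> and
  \<open>\<lambda>\<^sub>k\<^sub>+\<^sub>1\<close>, and \<open>{..<N}\<close> indexes the first \<open>N\<close> modes.
\<close>

definition eigenbasis :: "real^3 \<Rightarrow> (nat \<Rightarrow> pe_state) \<Rightarrow> (nat \<Rightarrow> real) \<Rightarrow> bool" where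
  "eigenbasis L e lam \<longleftrightarrow>
     (\<forall>k. (e k, \<lambda>x. lam k *\<^sub>R e k x) \<in> form_operator L) \<and>
     0 < lam 0 \<and> mono lam \<and> filterlim lam at_top sequentially \<and>
     (\<forall>j k. L2_inner L (e j) (e k) = (if j = k then 1 else 0)) \<and>
     (\<forall>U\<in>W_space L 0. (\<lambda>n. W_norm L 0 (U - P_proj L e n U)) \<longlonglongrightarrow> 0)"

definition determining_modes ::
    "real^3 \<Rightarrow> (real \<Rightarrow> pe_state \<Rightarrow> pe_state) \<Rightarrow> (nat \<Rightarrow> pe_state) \<Rightarrow> nat \<Rightarrow> bool" where
  "determining_modes L S e N \<longleftrightarrow>
     (\<forall>U\<in>W_space L 1. \<forall>U'\<in>W_space L 1.
        ((\<lambda>t. W_norm L 1 (P_proj L e N (S t U - S t U'))) \<longlongrightarrow> 0) at_top \<longrightarrow>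
        ((\<lambda>t. W_norm L 1 (S t U - S t U')) \<longlongrightarrow> 0) at_top)"

end

theory Submission
  imports Defs
begin

text \<open>
  Let \<open>d t\<close> be the \<open>W\<^sub>1\<close>-distance of two trajectories. Once both have entered \<open>D\<close>, the
  semigroup property, the splitting \<open>I = P\<^sub>N + Q\<^sub>N\<close> and the squeezing estimate give
  \<open>d (t + T) \<le> q * d t + p (t + T)\<close>, where \<open>p t \<rightarrow> 0\<close> is the size of the difference of the modes.
  As \<open>q < 1\<close> and \<open>d\<close> is bounded on compact time intervals by continuity, iteration yields
  \<open>d t \<rightarrow> 0\<close>. The semigroup property holds almost everywhere only: it follows from uniqueness of
  strong solutions, since the equations are autonomous. The triangle inequality for the norm
  of \<open>W\<^sub>1\<close> rests on uniqueness of weak derivatives, that is, on density of the periodic test functions.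
\<close>

section \<open>Integration over the period cell\<close>

lemma cell_subset_cbox: "cell L \<subseteq> cbox (vector [0, 0, - (L$3/2)]) (vector [L$1, L$2, L$3/2])"
  by (auto simp: cell_def mem_box_cart forall_3)

lemma open_cell: "open (cell L)"
  unfolding cell_def
  by (intro open_Collect_conj open_Collect_less continuous_intros)

lemma cell_borel [measurable]: "cell L \<in> sets borel"
  using open_cell by (rule borel_open)

lemma bounded_cell: "bounded (cell L)"
  using cell_subset_cbox bounded_cbox bounded_subset by blast

lemma emeasure_cell_finite: "emeasure lborel (cell L) < \<infinity>"
  by (rule emeasure_bounded_finite[OF bounded_cell])

lemma set_integrable_const_cell:
  fixes c :: "'a::euclidean_space"
  shows "set_integrable lborel (cell L) (\<lambda>_. c)"
  unfolding set_integrable_def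
  using emeasure_cell_finite by (intro integrable_scaleR_left) (simp add: integrable_indicator_iff)

text \<open>The cell has finite measure, so constants are integrable on it and
  \<open>1 + (norm (u x))\<^sup>2\<close> is an integrable majorant.\<close>

lemma Lp_cell_2_integrable:
  assumes "u \<in> Lp_cell L 2"
  shows "set_integrable lborel (cell L) u"
proof -
  have [measurable]: "u \<in> borel_measurable borel"
    and i: "set_integrable lborel (cell L) (\<lambda>x. (norm (u x))\<^sup>2)"
    using assms by (auto simp: Lp_cell_def)
  have "r \<le> 1 + r\<^sup>2" for r :: real
    using zero_le_power2[of "r - 1/2"] by (simp add: power2_diff field_simps)
  then have "norm (u x) \<le> 1 + (norm (u x))\<^sup>2" for x by blast
  then show ?thesis
    by (intro set_integrable_bound[OF set_integral_add(1)[OF set_integrable_const_cell[of L "1::real"] i]])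
       (auto simp: set_borel_measurable_def)
qed

text \<open>A continuous function is bounded on the compact box around the cell; that bound times
  the integrable function is a majorant.\<close>

lemma set_integrable_continuous_scaleR_cell:
  fixes u :: "real^3 \<Rightarrow> 'a::euclidean_space" and \<phi> :: "real^3 \<Rightarrow> real"
  assumes u: "set_integrable lborel (cell L) u" and [measurable]: "u \<in> borel_measurable borel"
    and \<phi>: "continuous_on UNIV \<phi>"
  shows "set_integrable lborel (cell L) (\<lambda>x. \<phi> x *\<^sub>R u x)"
proof -
  have [measurable]: "\<phi> \<in> borel_measurable borel"
    using \<phi> by (rule borel_measurable_continuous_onI)
  let ?B = "cbox (vector [0, 0, - (L$3/2)]) (vector [L$1, L$2, L$3/2]) :: (real^3) set"
  have "bounded (\<phi> ` ?B)"
    by (intro compact_imp_bounded compact_continuous_image continuous_on_subset[OF \<phi>]) auto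
  then obtain M where "\<And>x. x \<in> ?B \<Longrightarrow> \<bar>\<phi> x\<bar> \<le> M"
    by (auto simp: bounded_iff)
  then have M: "\<bar>\<phi> x\<bar> \<le> M" if "x \<in> cell L" for x
    using cell_subset_cbox that by blast
  show ?thesis
    by (rule set_integrable_bound[OF set_integrable_scaleR_right[of M, OF u]])
       (auto simp: set_borel_measurable_def intro!: mult_right_mono M order_trans[OF M] abs_ge_self AE_I2)
qed

section \<open>Density of periodic test functions\<close>

text \<open>
  Trigonometric polynomials are the pullbacks of polynomials under this embedding of the torus,
  so Stone--Weierstrass on its compact image makes the periodic test functions dense.
\<close>

definition torus_embedding :: "real^3 \<Rightarrow> real^3 \<Rightarrow> (real^3) \<times> (real^3)" where
  "torus_embedding L x = (\<chi> i. cos (2 * pi * x$i / L$i), \<chi> i. sin (2 * pi * x$i / L$i))"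

lemma continuous_torus_embedding: "continuous_on UNIV (torus_embedding L)"
  unfolding torus_embedding_def divide_inverse by (intro continuous_intros)

text \<open>Equal sines and cosines force each pair of coordinates to differ by an integer number of
  periods. Two points of the open cell differ by less than one period, so this integer is 0.\<close>

lemma inj_on_torus_embedding:
  assumes "\<forall>i. L$i > 0"
  shows "inj_on (torus_embedding L) (cell L)"
proof
  fix x y assume x: "x \<in> cell L" and y: "y \<in> cell L" and eq: "torus_embedding L x = torus_embedding L y"
  have "x$i = y$i" for i
  proof -
    have L: "L$i > 0" using assms by auto
    have "sin (2 * pi * x$i / L$i) = sin (2 * pi * y$i / L$i) \<and> cos (2 * pi * x$i / L$i) = cos (2 * pi * y$i / L$i)"
      using eq by (auto simp: torus_embedding_def vec_eq_iff)
    then obtain n::int where n: "2 * pi * x$i / L$i = 2 * pi * y$i / L$i + 2 * pi * n"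
      unfolding sin_cos_eq_iff by blast
    then have "2 * pi * x$i = 2 * pi * (y$i + n * L$i)"
      using L by (simp add: field_simps)
    then have n: "x$i = y$i + n * L$i" by simp
    have "\<bar>x$i - y$i\<bar> < L$i"
      using x y exhaust_3[of i] by (auto simp: cell_def abs_less_iff)
    then have "\<bar>real_of_int n\<bar> < 1"
      using L n by (simp add: abs_mult)
    then have "n = 0" by linarith
    then show "x$i = y$i" using n by simp
  qed
  then show "x = y" by (simp add: vec_eq_iff)
qed

text \<open>First harmonics suffice as generators, since products yield the higher ones. The
  inductive form reduces smoothness and periodicity to a check on the generators and the closure
  rules.\<close>

inductive trig_poly :: "real^3 \<Rightarrow> (real^3 \<Rightarrow> real) \<Rightarrow> bool" for L where
  trig_cos: "trig_poly L (\<lambda>x. cos (2 * pi * x$i / L$i))"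
| trig_sin: "trig_poly L (\<lambda>x. sin (2 * pi * x$i / L$i))"
| trig_const: "trig_poly L (\<lambda>x. c)"
| trig_add: "trig_poly L \<phi> \<Longrightarrow> trig_poly L \<psi> \<Longrightarrow> trig_poly L (\<lambda>x. \<phi> x + \<psi> x)"
| trig_mult: "trig_poly L \<phi> \<Longrightarrow> trig_poly L \<psi> \<Longrightarrow> trig_poly L (\<lambda>x. \<phi> x * \<psi> x)"

lemma classical_partial_eq:
  assumes "(\<phi> has_derivative D) (at x)"
  shows "classical_partial i \<phi> x = D (axis i 1)"
  using frechet_derivative_at[OF assms] by (simp add: classical_partial_def)

text \<open>The two claims are proved in one induction because the sum and product rules for the
  partial derivative need differentiability of both operands.\<close>

lemma trig_poly_partial:
  assumes "trig_poly L \<phi>"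
  shows "\<phi> differentiable (at x)" "trig_poly L (classical_partial i \<phi>)"
proof -
  have "(\<forall>x. \<phi> differentiable (at x)) \<and> trig_poly L (classical_partial i \<phi>)"
    using assms
  proof induction
    case (trig_cos j)
    have D: "((\<lambda>x::real^3. cos (2 * pi * x$j / L$j)) has_derivative
        (\<lambda>h. - sin (2 * pi * x$j / L$j) * (2 * pi * h$j / L$j))) (at x)" for x
      by (auto intro!: derivative_eq_intros bounded_linear.has_derivative[OF bounded_linear_vec_nth] simp: divide_inverse)
    have eq: "classical_partial i (\<lambda>x::real^3. cos (2 * pi * x$j / L$j)) =
        (\<lambda>x. (- (2 * pi * axis i 1 $ j / L$j)) * sin (2 * pi * x$j / L$j))"
      by (auto simp: classical_partial_eq[OF D])
    have "trig_poly L (classical_partial i (\<lambda>x::real^3. cos (2 * pi * x$j / L$j)))"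
      unfolding eq by (intro trig_poly.intros)
    then show ?case using D by (auto simp: differentiable_def)
  next
    case (trig_sin j)
    have D: "((\<lambda>x::real^3. sin (2 * pi * x$j / L$j)) has_derivative
        (\<lambda>h. cos (2 * pi * x$j / L$j) * (2 * pi * h$j / L$j))) (at x)" for x
      by (auto intro!: derivative_eq_intros bounded_linear.has_derivative[OF bounded_linear_vec_nth] simp: divide_inverse)
    have eq: "classical_partial i (\<lambda>x::real^3. sin (2 * pi * x$j / L$j)) =
        (\<lambda>x. (2 * pi * axis i 1 $ j / L$j) * cos (2 * pi * x$j / L$j))"
      by (auto simp: classical_partial_eq[OF D])
    have "trig_poly L (classical_partial i (\<lambda>x::real^3. sin (2 * pi * x$j / L$j)))"
      unfolding eq by (intro trig_poly.intros)
    then show ?case using D by (auto simp: differentiable_def)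
  next
    case (trig_const c)
    have "classical_partial i (\<lambda>x::real^3. c) = (\<lambda>x. 0)"
      by (auto simp: classical_partial_eq[OF has_derivative_const])
    then show ?case by (auto intro: trig_poly.intros)
  next
    case (trig_add \<phi> \<psi>)
    then have "((\<lambda>x. \<phi> x + \<psi> x) has_derivative
        (\<lambda>h. frechet_derivative \<phi> (at x) h + frechet_derivative \<psi> (at x) h)) (at x)" for x
      by (intro has_derivative_add) (auto simp: frechet_derivative_works[symmetric])
    then have "classical_partial i (\<lambda>x. \<phi> x + \<psi> x) = (\<lambda>x. classical_partial i \<phi> x + classical_partial i \<psi> x)"
      by (intro ext) (subst classical_partial_eq, assumption, simp add: classical_partial_def)
    with trig_add show ?case by (auto intro: trig_poly.intros)
  next
    case (trig_mult \<phi> \<psi>)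
    then have "((\<lambda>x. \<phi> x * \<psi> x) has_derivative
        (\<lambda>h. \<phi> x * frechet_derivative \<psi> (at x) h + frechet_derivative \<phi> (at x) h * \<psi> x)) (at x)" for x
      by (intro has_derivative_mult) (auto simp: frechet_derivative_works[symmetric])
    then have "classical_partial i (\<lambda>x. \<phi> x * \<psi> x) = (\<lambda>x. \<phi> x * classical_partial i \<psi> x + classical_partial i \<phi> x * \<psi> x)"
      by (intro ext) (subst classical_partial_eq, assumption, simp add: classical_partial_def)
    with trig_mult show ?case by (auto intro: trig_poly.intros)
  qed
  then show "\<phi> differentiable (at x)" "trig_poly L (classical_partial i \<phi>)" by auto
qed

text \<open>A shift by one period in direction \<open>i\<close> adds 2 pi to the arguments in
  coordinate \<open>i\<close> and leaves the others alone; cancelling the period requires it to be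
  nonzero.\<close>

lemma trig_poly_periodic:
  assumes "\<forall>i. L$i > 0" "trig_poly L \<phi>"
  shows "\<phi> (x + axis i (L$i)) = \<phi> x"
  using assms(2)
proof induction
  case (trig_cos j)
  have "L$j \<noteq> 0" using assms(1) by (metis less_irrefl)
  then show ?case by (cases "i = j") (auto simp: axis_def algebra_simps add_divide_distrib cos_add)
next
  case (trig_sin j)
  have "L$j \<noteq> 0" using assms(1) by (metis less_irrefl)
  then show ?case by (cases "i = j") (auto simp: axis_def algebra_simps add_divide_distrib sin_add)
qed auto

lemma trig_poly_test_per:
  assumes "\<forall>i. L$i > 0" "trig_poly L \<phi>"
  shows "\<phi> \<in> test_per L"
proof -
  have "trig_poly L (foldr classical_partial is \<phi>)" for "is"
    by (induction "is") (auto simp: assms trig_poly_partial)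
  then show ?thesis
    using trig_poly_partial trig_poly_periodic[OF assms] by (auto simp: test_per_def smooth_def)
qed

lemma trig_poly_sum:
  assumes "\<And>i. i \<in> I \<Longrightarrow> trig_poly L (\<phi> i)"
  shows "trig_poly L (\<lambda>x. \<Sum>i\<in>I. \<phi> i x)"
  using assms by (induction I rule: infinite_finite_induct) (auto intro: trig_poly.intros)

text \<open>A linear functional of the embedding is a combination of the cosines and sines, with its
  values on the basis vectors as coefficients. The remaining cases are the closure rules.\<close>

lemma trig_poly_polynomial:
  assumes "real_polynomial_function p"
  shows "trig_poly L (\<lambda>x. p (torus_embedding L x))"
  using assms
proof induction
  case (linear f)
  interpret bounded_linear f by fact
  have "f (torus_embedding L x) =
      (\<Sum>i\<in>UNIV. cos (2 * pi * x$i / L$i) * f (axis i 1, 0)) +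
      (\<Sum>i\<in>UNIV. sin (2 * pi * x$i / L$i) * f (0, axis i 1))" for x
  proof -
    have "torus_embedding L x =
      (\<Sum>i\<in>UNIV. cos (2 * pi * x$i / L$i) *\<^sub>R (axis i 1, 0)) +
      (\<Sum>i\<in>UNIV. sin (2 * pi * x$i / L$i) *\<^sub>R (0, axis i 1))"
      by (auto simp: torus_embedding_def fst_sum snd_sum prod_eq_iff vec_eq_iff axis_def
          if_distrib[of "\<lambda>a. _ * a"] sum.delta cong: if_cong)
    then show ?thesis by (simp only: add sum scaleR real_scaleR_def)
  qed
  then show ?case by (simp only:) (intro trig_poly.intros trig_poly_sum)
qed (auto intro: trig_poly.intros)

section \<open>From test functions to integrals over compact sets\<close>

text \<open>Polynomials approximate \<open>F\<close> uniformly on the compact image of the closed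
  box. Their pullbacks are test functions and contribute nothing, so the integral is at most
  \<open>\<epsilon>\<close> times the integral of the absolute value of \<open>g\<close>.\<close>

lemma integral_torus_continuous_zero:
  fixes g :: "real^3 \<Rightarrow> real"
  assumes L: "\<forall>i. L$i > 0"
    and g: "set_integrable lborel (cell L) g" and [measurable]: "g \<in> borel_measurable borel"
    and orth: "\<And>\<phi>. \<phi> \<in> test_per L \<Longrightarrow> (LINT x:cell L|lborel. \<phi> x * g x) = 0"
    and F: "continuous_on UNIV F"
  shows "(LINT x:cell L|lborel. F (torus_embedding L x) * g x) = 0"
proof -
  let ?E = "torus_embedding L"
  let ?K = "?E ` cbox (vector [0, 0, - (L$3/2)]) (vector [L$1, L$2, L$3/2])"
  let ?M = "LINT x:cell L|lborel. \<bar>g x\<bar>"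
  have ag: "set_integrable lborel (cell L) (\<lambda>x. \<bar>g x\<bar>)"
    using g by (rule set_integrable_abs)
  have int: "set_integrable lborel (cell L) (\<lambda>x. H (?E x) * g x)" if "continuous_on UNIV H" for H
    using set_integrable_continuous_scaleR_cell[OF g, of "\<lambda>x. H (?E x)"] that
      continuous_on_compose2[OF that continuous_torus_embedding] by simp
  have "\<bar>LINT x:cell L|lborel. F (?E x) * g x\<bar> \<le> \<epsilon> * ?M" if \<epsilon>: "\<epsilon> > 0" for \<epsilon>
  proof -
    have "compact ?K"
      by (intro compact_continuous_image continuous_on_subset[OF continuous_torus_embedding]) auto
    then obtain p where p: "real_polynomial_function p" and Fp: "\<And>y. y \<in> ?K \<Longrightarrow> \<bar>F y - p y\<bar> < \<epsilon>"
      using Stone_Weierstrass_real_polynomial_function[OF \<open>compact ?K\<close> continuous_on_subset[OF F subset_UNIV] \<epsilon>] by blast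
    have cp: "continuous_on UNIV p"
      using p by (simp add: continuous_at_imp_continuous_on continuous_real_polymonial_function)
    have zero: "(LINT x:cell L|lborel. p (?E x) * g x) = 0"
      using orth trig_poly_test_per[OF L trig_poly_polynomial[OF p]] by blast
    have "(LINT x:cell L|lborel. F (?E x) * g x) = (LINT x:cell L|lborel. F (?E x) * g x - p (?E x) * g x)"
      using set_integral_diff(2)[OF int[OF F] int[OF cp]] zero by simp
    also have "\<bar>\<dots>\<bar> \<le> (LINT x:cell L|lborel. \<bar>F (?E x) * g x - p (?E x) * g x\<bar>)"
      using integral_abs_bound[of lborel "\<lambda>x. indicator (cell L) x *\<^sub>R (F (?E x) * g x - p (?E x) * g x)"]
      by (simp add: set_lebesgue_integral_def abs_mult)
    also have "\<dots> \<le> (LINT x:cell L|lborel. \<epsilon> * \<bar>g x\<bar>)"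
    proof (rule set_integral_mono)
      show "set_integrable lborel (cell L) (\<lambda>x. \<bar>F (?E x) * g x - p (?E x) * g x\<bar>)"
        by (intro set_integrable_abs set_integral_diff(1) int F cp)
      show "set_integrable lborel (cell L) (\<lambda>x. \<epsilon> * \<bar>g x\<bar>)" using ag by simp
      fix x assume "x \<in> cell L"
      then have "?E x \<in> ?K" using cell_subset_cbox by blast
      then have "\<bar>F (?E x) - p (?E x)\<bar> * \<bar>g x\<bar> \<le> \<epsilon> * \<bar>g x\<bar>"
        using Fp[of "?E x"] by (intro mult_right_mono less_imp_le abs_ge_zero)
      then show "\<bar>F (?E x) * g x - p (?E x) * g x\<bar> \<le> \<epsilon> * \<bar>g x\<bar>"
        by (simp add: abs_mult flip: left_diff_distrib)
    qed
    finally show ?thesis by simp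
  qed
  \<comment> \<open>Passing to the limit \<epsilon> \<rightarrow> 0 avoids dividing by
    \<open>?M\<close>, which may vanish.\<close>
  then have ev: "eventually (\<lambda>\<epsilon>. \<bar>LINT x:cell L|lborel. F (?E x) * g x\<bar> \<le> \<epsilon> * ?M) (at_right 0)"
    by (auto simp: eventually_at_filter)
  have "((\<lambda>\<epsilon>. \<epsilon> * ?M) \<longlongrightarrow> 0 * ?M) (at_right 0)"
    by (intro tendsto_intros)
  from tendsto_lowerbound[OF this ev] show ?thesis by simp
qed

text \<open>Continuous functions on the embedded torus whose pullbacks converge to the indicator of
  \<open>C\<close> on the cell, combined with dominated convergence.\<close>

lemma integral_compact_zero:
  fixes g :: "real^3 \<Rightarrow> real"
  assumes L: "\<forall>i. L$i > 0"
    and g: "set_integrable lborel (cell L) g" and gm[measurable]: "g \<in> borel_measurable borel"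
    and orth: "\<And>\<phi>. \<phi> \<in> test_per L \<Longrightarrow> (LINT x:cell L|lborel. \<phi> x * g x) = 0"
    and C: "compact C" "C \<subseteq> cell L"
  shows "(LINT x:C|lborel. g x) = 0"
\<comment> \<open>By convention \<open>infdist\<close> to the empty set is 0, so the cut-offs below
  would be constantly 1 for empty \<open>C\<close>.\<close>
proof (cases "C = {}")
  case False
  let ?E = "torus_embedding L"
  \<comment> \<open>A cut-off equal to 1 on the image of \<open>C\<close> and, for positive
    \<open>n\<close>, equal to 0 at distance at least 1/n from it. Distances are taken in the target
    of the embedding, which makes the pullback periodic.\<close>
  define F where "F n y = max 0 (1 - real n * infdist y (?E ` C))" for n y
  have cF: "continuous_on UNIV (F n)" for n
    unfolding F_def by (intro continuous_intros)
  have closed: "closed (?E ` C)"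
    by (intro compact_imp_closed compact_continuous_image continuous_on_subset[OF continuous_torus_embedding] C) auto
  have [measurable]: "C \<in> sets borel" using C by (simp add: borel_compact)
  have cFE: "continuous_on UNIV (\<lambda>x. F n (?E x))" for n
    by (rule continuous_on_compose2[OF cF continuous_torus_embedding]) auto
  have [measurable]: "(\<lambda>x. F n (?E x)) \<in> borel_measurable borel" for n
    by (rule borel_measurable_continuous_onI[OF cFE])
  have lim: "(\<lambda>n. F n (?E x)) \<longlonglongrightarrow> indicator C x" if x: "x \<in> cell L" for x
  proof (cases "x \<in> C")
    case True
    then show ?thesis by (simp add: F_def)
  next
    case xC: False
    \<comment> \<open>Injectivity on the cell is essential here: a point outside \<open>C\<close>
      could otherwise be mapped into the image of \<open>C\<close>.\<close>
    have "?E x \<notin> ?E ` C"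
      using inj_on_torus_embedding[OF L] x xC C(2) by (auto simp: inj_on_def)
    then have pos: "infdist (?E x) (?E ` C) > 0"
      using infdist_pos_not_in_closed[OF closed] False by auto
    then obtain n0 :: nat where n0: "1 < real n0 * infdist (?E x) (?E ` C)"
      using reals_Archimedean3 by blast
    have "F n (?E x) = 0" if "n \<ge> n0" for n
    proof -
      have "1 < real n * infdist (?E x) (?E ` C)"
        using that n0 pos mult_right_mono[of "real n0" "real n" "infdist (?E x) (?E ` C)"] by linarith
      then show ?thesis by (simp add: F_def)
    qed
    then show ?thesis
      using xC by (intro tendsto_eventually eventually_sequentiallyI[of n0]) simp
  qed
  have "(\<lambda>n. LINT x:cell L|lborel. F n (?E x) * g x) \<longlonglongrightarrow> (LINT x:C|lborel. g x)"
    unfolding set_lebesgue_integral_def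
  proof (rule integral_dominated_convergence[where w="\<lambda>x. indicator (cell L) x *\<^sub>R \<bar>g x\<bar>"])
    show "integrable lborel (\<lambda>x. indicator (cell L) x *\<^sub>R \<bar>g x\<bar>)"
      using set_integrable_abs[OF g] by (simp add: set_integrable_def)
    show "AE x in lborel. (\<lambda>n. indicator (cell L) x *\<^sub>R (F n (?E x) * g x)) \<longlonglongrightarrow> indicator C x *\<^sub>R g x"
    proof (rule AE_I2)
      fix x show "(\<lambda>n. indicator (cell L) x *\<^sub>R (F n (?E x) * g x)) \<longlonglongrightarrow> indicator C x *\<^sub>R g x"
        using tendsto_mult[OF lim tendsto_const[of "g x"]] C(2) by (cases "x \<in> cell L") (auto simp: indicator_def)
    qed
    fix n show "AE x in lborel. norm (indicator (cell L) x *\<^sub>R (F n (?E x) * g x)) \<le> indicator (cell L) x *\<^sub>R \<bar>g x\<bar>"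
    proof (rule AE_I2)
      fix x have "\<bar>F n (?E x)\<bar> \<le> 1" by (auto simp: F_def max_def infdist_nonneg)
      then show "norm (indicator (cell L) x *\<^sub>R (F n (?E x) * g x)) \<le> indicator (cell L) x *\<^sub>R \<bar>g x\<bar>"
        using mult_right_mono[of "\<bar>F n (?E x)\<bar>" 1 "\<bar>g x\<bar>"] by (auto simp: indicator_def abs_mult)
    qed
  qed auto
  then show ?thesis
    using integral_torus_continuous_zero[OF L g gm orth cF] by (simp add: LIMSEQ_const_iff)
qed (simp add: set_lebesgue_integral_def)

text \<open>If \<open>g\<close> were positive on a set of positive measure, inner regularity would
  supply a compact subset of positive measure, and the integral of \<open>g\<close> over it could
  not vanish.\<close>

lemma AE_le_zero_if_integral_compact_zero:
  fixes g :: "real^3 \<Rightarrow> real"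
  assumes g: "set_integrable lborel (cell L) g" and [measurable]: "g \<in> borel_measurable borel"
    and zero: "\<And>C. compact C \<Longrightarrow> C \<subseteq> cell L \<Longrightarrow> (LINT x:C|lborel. g x) = 0"
  shows "AE x\<in>cell L in lborel. g x \<le> 0"
proof -
  let ?P = "{x \<in> cell L. g x > 0}"
  have P[measurable]: "?P \<in> sets borel" by measurable
  have bP: "bounded ?P" by (rule bounded_subset[OF bounded_cell]) auto
  have fP: "emeasure lborel ?P < \<infinity>" by (rule emeasure_bounded_finite[OF bP])
  have "emeasure lborel ?P = 0"
  proof (rule ccontr)
    assume ne: "emeasure lborel ?P \<noteq> 0"
    then have pos: "measure lborel ?P > 0"

      using fP by (metis emeasure_eq_ennreal_measure ennreal_0 infinity_ennreal_def less_irrefl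
          measure_nonneg order_le_less)
    have "?P \<in> sets lebesgue" using P by auto
    \<comment> \<open>The admissible error is the measure of \<open>?P\<close> itself, so that a
      null set \<open>C\<close> is already contradictory.\<close>
    then obtain C where C: "closed C" "C \<subseteq> ?P" "emeasure lebesgue (?P - C) < ennreal (measure lborel ?P)"
      by (rule sets_lebesgue_inner_closed[OF _ pos])
    have [measurable]: "C \<in> sets borel" using C by auto
    have cC: "compact C"
      using C(1) bounded_subset[OF bP C(2)] by (simp add: compact_eq_bounded_closed)
    have zC: "(LINT x:C|lborel. g x) = 0" using zero[OF cC] C(2) by blast
    have "C \<in> null_sets lborel"
    proof (rule null_if_pos_func_has_zero_int)
      show "integrable lborel (\<lambda>x. indicator C x *\<^sub>R g x)"
        using set_integrable_subset[OF g, of C] C(2) by (auto simp: set_integrable_def)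
      show "AE x\<in>C in lborel. 0 < indicator C x *\<^sub>R g x" using C(2) by auto
      have "(LINT x:C|lborel. indicator C x *\<^sub>R g x) = (LINT x:C|lborel. g x)"
        by (rule set_lebesgue_integral_cong) auto
      then show "(LINT x:C|lborel. indicator C x *\<^sub>R g x) = 0"
        using zC by simp
    qed auto
    then have "emeasure lborel ?P = emeasure lborel (?P - C)"
      by (subst emeasure_Diff_null_set) auto
    also have "\<dots> < emeasure lborel ?P"
      using C(3) fP by (simp add: emeasure_eq_ennreal_measure less_top)
    finally show False by simp
  qed
  then have "?P \<in> null_sets lborel" by auto
  then show ?thesis
    by (rule AE_not_in[THEN eventually_mono]) auto
qed

lemma test_per_continuous:
  assumes "\<phi> \<in> test_per L"
  shows "continuous_on UNIV \<phi>" "continuous_on UNIV (classical_partial i \<phi>)"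
proof -
  \<comment> \<open>The lists of length 0 and 1 in \<open>smooth\<close> give differentiability of
    \<phi> and of its first partial derivatives.\<close>
  have "foldr classical_partial [] \<phi> differentiable (at x)" "foldr classical_partial [i] \<phi> differentiable (at x)" for x
    using assms unfolding test_per_def smooth_def by blast+
  then show "continuous_on UNIV \<phi>" "continuous_on UNIV (classical_partial i \<phi>)"
    by (auto intro!: continuous_at_imp_continuous_on differentiable_imp_continuous_within)
qed

text \<open>The scalar result bounds every component from above by 0; using it for \<open>b\<close>
  and \<open>- b\<close> makes the component vanish, and the basis is finite.\<close>

lemma test_per_orthogonal_imp_zero:
  fixes g :: "real^3 \<Rightarrow> 'a::euclidean_space"
  assumes L: "\<forall>i. L$i > 0" and g: "g \<in> Lp_cell L 2"
    and orth: "\<And>\<phi>. \<phi> \<in> test_per L \<Longrightarrow> (LINT x:cell L|lborel. \<phi> x *\<^sub>R g x) = 0"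
  shows "AE x\<in>cell L in lborel. g x = 0"
proof -
  have gm[measurable]: "g \<in> borel_measurable borel" using g by (simp add: Lp_cell_def)
  have gi: "set_integrable lborel (cell L) g" using g by (rule Lp_cell_2_integrable)
  have le: "AE x\<in>cell L in lborel. g x \<bullet> b \<le> 0" for b
  proof (rule AE_le_zero_if_integral_compact_zero)
    show gb: "set_integrable lborel (cell L) (\<lambda>x. g x \<bullet> b)"
      using integrable_inner_left[OF gi[unfolded set_integrable_def], of b]
      by (simp add: set_integrable_def)
    show m: "(\<lambda>x. g x \<bullet> b) \<in> borel_measurable borel" by measurable
    have "(LINT x:cell L|lborel. \<phi> x * (g x \<bullet> b)) = 0" if \<phi>: "\<phi> \<in> test_per L" for \<phi>
    proof -
      from test_per_continuous(1)[OF \<phi>] have "set_integrable lborel (cell L) (\<lambda>x. \<phi> x *\<^sub>R g x)"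
        by (rule set_integrable_continuous_scaleR_cell[OF gi gm])
      then have "(LINT x:cell L|lborel. \<phi> x * (g x \<bullet> b)) = (LINT x:cell L|lborel. \<phi> x *\<^sub>R g x) \<bullet> b"
        unfolding set_lebesgue_integral_def set_integrable_def
        by (subst integral_inner_left[symmetric]) (auto simp: mult.assoc)
      then show ?thesis using orth[OF \<phi>] by simp
    qed
    then show "(LINT x:C|lborel. g x \<bullet> b) = 0" if "compact C" "C \<subseteq> cell L" for C
      using integral_compact_zero[OF L gb m] that by blast
  qed
  have "AE x in lborel. \<forall>b\<in>Basis. x \<in> cell L \<longrightarrow> g x \<bullet> b = 0"
    unfolding AE_finite_all[OF finite_Basis]
  proof
    fix b show "AE x\<in>cell L in lborel. g x \<bullet> b = 0"
      using le[of b] le[of "- b"] by eventually_elim auto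
  qed
  then show ?thesis
    by eventually_elim (simp add: euclidean_eq_iff[where 'a='a])
qed

section \<open>The first order Sobolev norm\<close>

lemma Lp_cell_2_add:
  assumes "u \<in> Lp_cell L 2" "w \<in> Lp_cell L 2"
  shows "(\<lambda>x. u x + w x) \<in> Lp_cell L 2"
proof -
  have [measurable]: "u \<in> borel_measurable borel" "w \<in> borel_measurable borel"
    and i: "set_integrable lborel (cell L) (\<lambda>x. (norm (u x))\<^sup>2)" "set_integrable lborel (cell L) (\<lambda>x. (norm (w x))\<^sup>2)"
    using assms by (auto simp: Lp_cell_def)
  have "(norm (u x + w x))\<^sup>2 \<le> 2 * ((norm (u x))\<^sup>2 + (norm (w x))\<^sup>2)" for x
  proof -
    have "(norm (u x + w x))\<^sup>2 \<le> (norm (u x) + norm (w x))\<^sup>2"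
      by (intro power_mono norm_triangle_ineq) simp
    also have "\<dots> \<le> 2 * ((norm (u x))\<^sup>2 + (norm (w x))\<^sup>2)"
      using sum_squares_bound[of "norm (u x)" "norm (w x)"] by (simp add: power2_sum)
    finally show ?thesis .
  qed
  then have "set_integrable lborel (cell L) (\<lambda>x. (norm (u x + w x))\<^sup>2)"
    by (intro set_integrable_bound[OF set_integrable_mult_right[of 2, OF set_integral_add(1)[OF i]]])
       (auto simp: set_borel_measurable_def)
  then show ?thesis by (simp add: Lp_cell_def)
qed

lemma Lp_cell_2_scaleR:
  assumes "u \<in> Lp_cell L 2"
  shows "(\<lambda>x. c *\<^sub>R u x) \<in> Lp_cell L 2"
  using assms by (auto simp: Lp_cell_def power_mult_distrib)

text \<open>Minkowski's inequality obtained by integrating a weighted Young inequality: with the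
  norms \<open>a\<close> and \<open>b\<close> as weights the right-hand side integrates to at most
  the square of \<open>a + b\<close>.\<close>

lemma L2_norm_triangle:
  assumes "u \<in> Lp_cell L 2" "w \<in> Lp_cell L 2"
  shows "L2_norm L (\<lambda>x. u x + w x) \<le> L2_norm L u + L2_norm L w"
proof (rule field_le_epsilon)
  fix \<epsilon> :: real assume \<epsilon>: "\<epsilon> > 0"
  have i: "set_integrable lborel (cell L) (\<lambda>x. (norm (u x))\<^sup>2)" "set_integrable lborel (cell L) (\<lambda>x. (norm (w x))\<^sup>2)"
    and iuw: "set_integrable lborel (cell L) (\<lambda>x. (norm (u x + w x))\<^sup>2)"
    using assms Lp_cell_2_add[OF assms] by (auto simp: Lp_cell_def)
  \<comment> \<open>The extra \<epsilon>/2 keeps both numbers positive, so that they may serve as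
    divisors even if a norm is 0.\<close>
  define a b where "a = L2_norm L u + \<epsilon>/2" and "b = L2_norm L w + \<epsilon>/2"
  have nonneg: "(LINT x:cell L|lborel. (norm (f x))\<^sup>2) \<ge> 0" for f :: "real^3 \<Rightarrow> 'a"
    by (auto simp: set_lebesgue_integral_def intro!: Bochner_Integration.integral_nonneg)
  have ab: "a > 0" "b > 0"
    using \<epsilon> nonneg by (auto simp: a_def b_def L2_norm_def intro!: add_nonneg_pos)
  have sq: "(LINT x:cell L|lborel. (norm (u x))\<^sup>2) \<le> a\<^sup>2" "(LINT x:cell L|lborel. (norm (w x))\<^sup>2) \<le> b\<^sup>2"
    using \<epsilon> nonneg by (auto simp: a_def b_def L2_norm_def intro!: sqrt_le_D)
  \<comment> \<open>Young's inequality with the weights that are optimal for the norms \<open>a\<close> and \<open>b\<close>\<close>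
  have young: "(norm (u x + w x))\<^sup>2 \<le> (1 + b/a) * (norm (u x))\<^sup>2 + (1 + a/b) * (norm (w x))\<^sup>2" for x
  proof -
    have "(norm (u x + w x))\<^sup>2 \<le> (norm (u x) + norm (w x))\<^sup>2"
      by (intro power_mono norm_triangle_ineq) simp
    also have "\<dots> \<le> (1 + b/a) * (norm (u x))\<^sup>2 + (1 + a/b) * (norm (w x))\<^sup>2"
    proof -
      have "(1 + b/a) * r\<^sup>2 + (1 + a/b) * s\<^sup>2 - (r + s)\<^sup>2 = (b * r - a * s)\<^sup>2 / (a * b)" for r s
        using ab by (simp add: field_simps power2_eq_square)
      moreover have "(b * r - a * s)\<^sup>2 / (a * b) \<ge> 0" for r s using ab by simp
      ultimately show ?thesis by (metis diff_ge_0_iff_ge)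
    qed
    finally show ?thesis .
  qed
  have "(LINT x:cell L|lborel. (norm (u x + w x))\<^sup>2) \<le>
      (LINT x:cell L|lborel. (1 + b/a) * (norm (u x))\<^sup>2 + (1 + a/b) * (norm (w x))\<^sup>2)"
    by (intro set_integral_mono iuw set_integral_add(1) set_integrable_mult_right i young)
  also have "\<dots> = (1 + b/a) * (LINT x:cell L|lborel. (norm (u x))\<^sup>2) + (1 + a/b) * (LINT x:cell L|lborel. (norm (w x))\<^sup>2)"
    by (subst set_integral_add(2)) (auto intro!: i set_integrable_mult_right)
  also have "\<dots> \<le> (1 + b/a) * a\<^sup>2 + (1 + a/b) * b\<^sup>2"
    using ab by (intro add_mono mult_left_mono sq) auto
  also have "\<dots> = (a + b)\<^sup>2"
    using ab by (simp add: field_simps power2_eq_square)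
  finally have "L2_norm L (\<lambda>x. u x + w x) \<le> a + b"
    using ab by (auto simp: L2_norm_def intro!: real_le_lsqrt)
  then show "L2_norm L (\<lambda>x. u x + w x) \<le> L2_norm L u + L2_norm L w + \<epsilon>"
    by (simp add: a_def b_def)
qed

lemma L2_norm_cong_AE:
  assumes [measurable]: "u \<in> borel_measurable borel" "w \<in> borel_measurable borel"
    and "AE x\<in>cell L in lborel. u x = w x"
  shows "L2_norm L u = L2_norm L w"
proof -
  have "(LINT x:cell L|lborel. (norm (u x))\<^sup>2) = (LINT x:cell L|lborel. (norm (w x))\<^sup>2)"
    using assms(3) by (intro set_lebesgue_integral_cong_AE) (auto elim!: eventually_mono)
  then show ?thesis by (simp add: L2_norm_def)
qed

lemma L2_perD:
  assumes "u \<in> L2_per L"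
  shows "u \<in> Lp_cell L 2" "u \<in> borel_measurable borel"
  using assms by (auto simp: L2_per_def Lp_cell_def)

lemma L2_per_add: "u \<in> L2_per L \<Longrightarrow> w \<in> L2_per L \<Longrightarrow> (\<lambda>x. u x + w x) \<in> L2_per L"
  by (auto simp: L2_per_def Lp_cell_2_add elim: eventually_elim2)

lemma L2_per_scaleR: "u \<in> L2_per L \<Longrightarrow> (\<lambda>x. c *\<^sub>R u x) \<in> L2_per L"
  by (auto simp: L2_per_def Lp_cell_2_scaleR elim: eventually_mono)

lemma set_integrable_test_per:
  assumes "\<phi> \<in> test_per L" "u \<in> L2_per L"
  shows "set_integrable lborel (cell L) (\<lambda>x. \<phi> x *\<^sub>R u x)"
    "set_integrable lborel (cell L) (\<lambda>x. classical_partial i \<phi> x *\<^sub>R u x)"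
  using test_per_continuous[OF assms(1)] L2_perD[OF assms(2)]
  by (auto intro: set_integrable_continuous_scaleR_cell Lp_cell_2_integrable)

section \<open>Linearity and uniqueness of weak derivatives\<close>

lemma has_weak_partial_add:
  assumes "has_weak_partial L i u g" "has_weak_partial L i w h"
  shows "has_weak_partial L i (\<lambda>x. u x + w x) (\<lambda>x. g x + h x)"
  using assms
  by (auto simp: has_weak_partial_def L2_per_add scaleR_add_right set_integral_add(2) set_integrable_test_per)

lemma has_weak_partial_scaleR:
  assumes "has_weak_partial L i u g"
  shows "has_weak_partial L i (\<lambda>x. c *\<^sub>R u x) (\<lambda>x. c *\<^sub>R g x)"
  using assms
  by (auto simp: has_weak_partial_def L2_per_scaleR scaleR_left_commute[of _ c] simp del: scaleR_scaleR)

text \<open>The difference of two weak derivatives of \<open>u\<close> is a weak derivative of 0,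
  hence orthogonal to all test functions, hence 0 almost everywhere by density.\<close>

lemma has_weak_partial_unique:
  assumes L: "\<forall>i. L$i > 0" and g: "has_weak_partial L i u g" and h: "has_weak_partial L i u h"
  shows "AE x\<in>cell L in lborel. g x = h x"
proof -
  have 0: "has_weak_partial L i (\<lambda>x. u x + (-1) *\<^sub>R u x) (\<lambda>x. g x + (-1) *\<^sub>R h x)"
    by (intro has_weak_partial_add has_weak_partial_scaleR g h)
  have "AE x\<in>cell L in lborel. g x + (-1) *\<^sub>R h x = 0"
    by (rule test_per_orthogonal_imp_zero[OF L])
       (use 0 in \<open>auto simp: has_weak_partial_def dest: L2_perD\<close>)
  then show ?thesis by simp
qed

lemma H_per_1_iff: "u \<in> H_per L 1 \<longleftrightarrow> u \<in> L2_per L \<and> (\<forall>i. \<exists>g. has_weak_partial L i u g)"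
  by (auto simp: has_weak_partial_def)

lemma has_weak_partial_wpartial:
  assumes "u \<in> H_per L 1"
  shows "has_weak_partial L i u (wpartial L i u)"
  using assms unfolding H_per_1_iff wpartial_def by (metis someI_ex)

lemma H_per_1_add: "u \<in> H_per L 1 \<Longrightarrow> w \<in> H_per L 1 \<Longrightarrow> (\<lambda>x. u x + w x) \<in> H_per L 1"
  unfolding H_per_1_iff by (fast intro: L2_per_add has_weak_partial_add)

lemma H_per_1_scaleR: "u \<in> H_per L 1 \<Longrightarrow> (\<lambda>x. c *\<^sub>R u x) \<in> H_per L 1"
  unfolding H_per_1_iff by (fast intro: L2_per_scaleR has_weak_partial_scaleR)

text \<open>As \<open>wpartial\<close> is an arbitrary choice, it is linear only up to null sets.
  This lets any convenient weak derivative replace the chosen one inside the norm.\<close>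

lemma L2_norm_wpartial_eq:
  assumes "\<forall>i. L$i > 0" "has_weak_partial L i u g"
  shows "L2_norm L (wpartial L i u) = L2_norm L g"
proof -
  have w: "has_weak_partial L i u (wpartial L i u)"
    using assms(2) unfolding wpartial_def by (rule someI[where P="has_weak_partial L i u"])
  show ?thesis
    using has_weak_partial_unique[OF assms(1) w assms(2)] w assms(2)
    by (intro L2_norm_cong_AE) (auto simp: has_weak_partial_def dest: L2_perD)
qed

lemma L2_norm_scaleR: "L2_norm L (\<lambda>x. c *\<^sub>R u x) = \<bar>c\<bar> * L2_norm L u"
  by (simp add: L2_norm_def power_mult_distrib real_sqrt_mult)

lemma L2_norm_nonneg: "L2_norm L u \<ge> 0"
  by (auto simp: L2_norm_def set_lebesgue_integral_def intro!: Bochner_Integration.integral_nonneg)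

section \<open>Norm properties in the order one spaces\<close>

lemma Hdot_norm_1: "Hdot_norm L 1 u = L2_set (\<lambda>i. L2_norm L (wpartial L i u)) UNIV"
  by (simp add: Hdot_norm_def L2_set_def)

lemma Hdot_norm_1_nonneg: "0 \<le> Hdot_norm L 1 u"
  unfolding Hdot_norm_1 by (rule L2_set_nonneg)

text \<open>Minkowski's inequality is used twice: in the integral for each partial derivative, then
  in the finite sum over the directions.\<close>

lemma Hdot_norm_1_triangle:
  assumes L: "\<forall>i. L$i > 0" and u: "u \<in> H_per L 1" and w: "w \<in> H_per L 1"
  shows "Hdot_norm L 1 (\<lambda>x. u x + w x) \<le> Hdot_norm L 1 u + Hdot_norm L 1 w"
proof -
  have "L2_norm L (wpartial L i (\<lambda>x. u x + w x)) \<le> L2_norm L (wpartial L i u) + L2_norm L (wpartial L i w)" for i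
    unfolding L2_norm_wpartial_eq[OF L has_weak_partial_add[OF has_weak_partial_wpartial[OF u] has_weak_partial_wpartial[OF w]]]
    using has_weak_partial_wpartial[OF u, of i] has_weak_partial_wpartial[OF w, of i]
    by (intro L2_norm_triangle) (auto simp: has_weak_partial_def dest: L2_perD)
  then show ?thesis
    unfolding Hdot_norm_1 by (intro order_trans[OF L2_set_mono L2_set_triangle_ineq] L2_norm_nonneg)
qed

lemma Hdot_norm_1_scaleR:
  assumes L: "\<forall>i. L$i > 0" and u: "u \<in> H_per L 1"
  shows "Hdot_norm L 1 (\<lambda>x. c *\<^sub>R u x) = \<bar>c\<bar> * Hdot_norm L 1 u"
  unfolding Hdot_norm_1 L2_norm_wpartial_eq[OF L has_weak_partial_scaleR[OF has_weak_partial_wpartial[OF u]]]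
  by (simp add: L2_norm_scaleR L2_set_right_distrib)

text \<open>
  Functions that agree almost everywhere have the same weak derivatives, so \<open>wpartial\<close> chooses
  the same function for both.
\<close>

lemma Hdot_norm_1_cong_AE:
  assumes u: "u \<in> L2_per L" and w: "w \<in> L2_per L" and eq: "AE x\<in>cell L in lborel. u x = w x"
  shows "Hdot_norm L 1 u = Hdot_norm L 1 w"
proof -
  have "(LINT x:cell L|lborel. \<psi> x *\<^sub>R u x) = (LINT x:cell L|lborel. \<psi> x *\<^sub>R w x)"
    if "continuous_on UNIV \<psi>" for \<psi> :: "real^3 \<Rightarrow> real"
    using eq L2_perD[OF u] L2_perD[OF w] borel_measurable_continuous_onI[OF that]
    by (intro set_lebesgue_integral_cong_AE) (auto elim!: eventually_mono)
  then have "has_weak_partial L i u = has_weak_partial L i w" for i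
    using u w test_per_continuous by (auto simp: fun_eq_iff has_weak_partial_def)
  then show ?thesis unfolding Hdot_norm_1 by (simp add: wpartial_def)
qed

text \<open>
  The parity and divergence constraints in \<open>W_space\<close> play no role for \<open>W_norm L 1\<close>; dropping
  them gives a space whose closure under linear combinations is immediate.
\<close>

definition H1_states :: "real^3 \<Rightarrow> pe_state set" where
  "H1_states L = {U. fst \<circ> U \<in> H_per L 1 \<and> snd \<circ> U \<in> H_per L 1}"

lemma W_space_1_subset: "W_space L 1 \<subseteq> H1_states L"
  by (auto simp: W_space_def V_space_def E_space_def Hdot_per_def H1_states_def)

lemma H1_statesD:
  assumes "U \<in> H1_states L"
  shows "fst \<circ> U \<in> L2_per L" "snd \<circ> U \<in> L2_per L" "U \<in> borel_measurable borel"
proof -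
  show 1: "fst \<circ> U \<in> L2_per L" and 2: "snd \<circ> U \<in> L2_per L"
    using assms unfolding H1_states_def H_per_1_iff by blast+
  have "U = (\<lambda>x. ((fst \<circ> U) x, (snd \<circ> U) x))" by auto
  then show "U \<in> borel_measurable borel"
    using borel_measurable_Pair[OF L2_perD(2)[OF 1] L2_perD(2)[OF 2]] by simp
qed

lemma H1_states_add: "U \<in> H1_states L \<Longrightarrow> W \<in> H1_states L \<Longrightarrow> (\<lambda>x. U x + W x) \<in> H1_states L"
  using H_per_1_add[of "fst \<circ> U" L "fst \<circ> W"] H_per_1_add[of "snd \<circ> U" L "snd \<circ> W"]
  by (simp add: H1_states_def o_def)

lemma H1_states_scaleR: "U \<in> H1_states L \<Longrightarrow> (\<lambda>x. c *\<^sub>R U x) \<in> H1_states L"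
  using H_per_1_scaleR[of "fst \<circ> U" L c] H_per_1_scaleR[of "snd \<circ> U" L c]
  by (simp add: H1_states_def o_def)

lemma H1_states_diff: "U \<in> H1_states L \<Longrightarrow> W \<in> H1_states L \<Longrightarrow> U - W \<in> H1_states L"
  using H1_states_add[OF _ H1_states_scaleR[of W L "-1"], of U] by (simp add: fun_diff_def)

lemma W_norm_1_triangle:
  assumes L: "\<forall>i. L$i > 0" and "U \<in> H1_states L" "W \<in> H1_states L"
  shows "W_norm L 1 (\<lambda>x. U x + W x) \<le> W_norm L 1 U + W_norm L 1 W"
proof -
  have "Hdot_norm L 1 (fst \<circ> (\<lambda>x. U x + W x)) \<le> Hdot_norm L 1 (fst \<circ> U) + Hdot_norm L 1 (fst \<circ> W)"
    "Hdot_norm L 1 (snd \<circ> (\<lambda>x. U x + W x)) \<le> Hdot_norm L 1 (snd \<circ> U) + Hdot_norm L 1 (snd \<circ> W)"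
    using assms Hdot_norm_1_triangle[OF L, of "fst \<circ> U" "fst \<circ> W"] Hdot_norm_1_triangle[OF L, of "snd \<circ> U" "snd \<circ> W"]
    by (auto simp: H1_states_def o_def)
  then show ?thesis
    unfolding W_norm_def
    by (intro order_trans[OF _ real_sqrt_sum_squares_triangle_ineq] real_sqrt_le_mono add_mono power_mono
        Hdot_norm_1_nonneg)
qed

lemma W_norm_1_uminus:
  assumes L: "\<forall>i. L$i > 0" and "U \<in> H1_states L"
  shows "W_norm L 1 (\<lambda>x. - U x) = W_norm L 1 U"
  using assms Hdot_norm_1_scaleR[OF L, of "fst \<circ> U" "-1"] Hdot_norm_1_scaleR[OF L, of "snd \<circ> U" "-1"]
  by (simp add: H1_states_def o_def W_norm_def)

lemma W_norm_1_diff_commute: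
  assumes L: "\<forall>i. L$i > 0" and "U \<in> H1_states L" "W \<in> H1_states L"
  shows "W_norm L 1 (U - W) = W_norm L 1 (W - U)"
  using W_norm_1_uminus[OF L H1_states_diff[OF assms(2,3)]] by (simp add: fun_diff_def)

text \<open>The distance of two states depends continuously on both. One direction comes from
  writing \<open>U - W\<close> as the sum of \<open>U' - W'\<close>, \<open>U - U'\<close> and
  \<open>W' - W\<close>.\<close>

lemma W_norm_1_diff_triangle:
  assumes L: "\<forall>i. L$i > 0" and U: "U \<in> H1_states L" "U' \<in> H1_states L"
    and W: "W \<in> H1_states L" "W' \<in> H1_states L"
  shows "\<bar>W_norm L 1 (U - W) - W_norm L 1 (U' - W')\<bar> \<le> W_norm L 1 (U - U') + W_norm L 1 (W - W')"
proof -
  \<comment> \<open>Stated for arbitrary states so that it can be used again with primed and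
    unprimed states exchanged.\<close>
  have *: "W_norm L 1 (U - W) \<le> W_norm L 1 (U' - W') + (W_norm L 1 (U - U') + W_norm L 1 (W - W'))"
    if "U \<in> H1_states L" "U' \<in> H1_states L" "W \<in> H1_states L" "W' \<in> H1_states L" for U U' W W'
  proof -
    have m: "(\<lambda>x. (U - U') x + (W' - W) x) \<in> H1_states L"
      by (intro H1_states_add H1_states_diff that)
    have eq: "U - W = (\<lambda>x. (U' - W') x + ((U - U') x + (W' - W) x))"
      by (auto simp: fun_eq_iff)
    have "W_norm L 1 (U - W) \<le> W_norm L 1 (U' - W') + W_norm L 1 (\<lambda>x. (U - U') x + (W' - W) x)"
      unfolding eq by (rule W_norm_1_triangle[OF L H1_states_diff[OF that(2,4)] m])
    also have "W_norm L 1 (\<lambda>x. (U - U') x + (W' - W) x) \<le> W_norm L 1 (U - U') + W_norm L 1 (W' - W)"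
      by (rule W_norm_1_triangle[OF L H1_states_diff[OF that(1,2)] H1_states_diff[OF that(4,3)]])
    also have "W_norm L 1 (W' - W) = W_norm L 1 (W - W')"
      by (rule W_norm_1_diff_commute[OF L that(4,3)])
    finally show ?thesis by (simp add: fun_diff_def)
  qed
  show ?thesis
    using *[OF U W] *[OF U(2,1) W(2,1)] W_norm_1_diff_commute[OF L U] W_norm_1_diff_commute[OF L W]
    by linarith
qed

text \<open>Needed because the semigroup identity is available only almost everywhere.\<close>

lemma W_norm_1_cong_AE:
  assumes U: "U \<in> H1_states L" and W: "W \<in> H1_states L" and eq: "AE x\<in>cell L in lborel. U x = W x"
  shows "W_norm L 1 U = W_norm L 1 W"
proof -
  have "Hdot_norm L 1 (fst \<circ> U) = Hdot_norm L 1 (fst \<circ> W)" "Hdot_norm L 1 (snd \<circ> U) = Hdot_norm L 1 (snd \<circ> W)"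
    using eq by (intro Hdot_norm_1_cong_AE H1_statesD U W; auto elim!: eventually_mono)+
  then show ?thesis by (simp add: W_norm_def)
qed

section \<open>Spectral projectors on states\<close>

lemma P_proj_H1_states:
  assumes e: "\<And>k. k < N \<Longrightarrow> e k \<in> H1_states L" and U: "U \<in> H1_states L"
  shows "P_proj L e N U \<in> H1_states L"
proof -
  have "(\<lambda>x. \<Sum>k<n. c k *\<^sub>R e k x) \<in> H1_states L" if "n \<le> N" for n c
    using that
  proof (induction n)
    case 0
    \<comment> \<open>The empty sum is written as 0 times \<open>U\<close>, since for
      \<open>N = 0\<close> no mode is at hand.\<close>
    then show ?case using H1_states_scaleR[OF U, of 0] by simp
  next
    case (Suc n)
    then show ?case
      using H1_states_add[of "\<lambda>x. \<Sum>k<n. c k *\<^sub>R e k x" L "\<lambda>x. c n *\<^sub>R e n x"] H1_states_scaleR[OF e, of n "c n"]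
      by simp
  qed
  from this[OF order_refl] show ?thesis unfolding P_proj_def .
qed

text \<open>The equality holds at every point: a state enters its projection only through integrals
  against the modes.\<close>

lemma P_proj_cong_AE:
  assumes "\<And>k. k < N \<Longrightarrow> e k \<in> H1_states L" "U \<in> H1_states L" "W \<in> H1_states L"
    and eq: "AE x\<in>cell L in lborel. U x = W x"
  shows "P_proj L e N U = P_proj L e N W"
proof -
  have "L2_inner L U (e k) = L2_inner L W (e k)" if "k < N" for k
    unfolding L2_inner_def
    using eq H1_statesD(3)[OF assms(1)[OF that]] H1_statesD(3)[OF assms(2)] H1_statesD(3)[OF assms(3)]
    by (intro set_lebesgue_integral_cong_AE) (auto elim!: eventually_mono)
  then show ?thesis by (simp add: P_proj_def)
qed

section \<open>Translation in time\<close>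

lemma AE_lborel_shift:
  fixes c :: "'a::euclidean_space"
  assumes "AE x in lborel. P x"
  shows "AE x in lborel. P (c + x)"
proof (rule AE_distrD[of "(+) c" lborel borel P])
  show "AE x in distr lborel borel ((+) c). P x"
    unfolding lborel_distr_plus by (rule assms)
qed simp

lemma integrable_lborel_shift:
  fixes f :: "'a::euclidean_space \<Rightarrow> 'b::{banach, second_countable_topology}"
  assumes "integrable lborel f"
  shows "integrable lborel (\<lambda>x. f (c + x))"
  using integrable_distr[of "(+) c" lborel borel f] assms by (simp add: lborel_distr_plus)

text \<open>A forward shift maps the positive half-line into itself, and Lebesgue measure is
  translation invariant.\<close>

lemma AE_greaterThan_shift:
  assumes "AE t\<in>{0<..} in lborel. P (t::real)" "0 \<le> h"
  shows "AE t\<in>{0<..} in lborel. P (h + t)"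
  using AE_lborel_shift[OF assms(1), of h] by eventually_elim (use assms(2) in auto)

lemma has_time_derivative_shift:
  assumes U: "has_time_derivative L U dU" and h: "0 \<le> h"
  shows "has_time_derivative L (\<lambda>t. U (h + t)) (\<lambda>t. dU (h + t))"
  unfolding has_time_derivative_def
proof (intro conjI allI impI)
  have m: "(\<lambda>(t, x). dU t x) \<in> borel_measurable borel"
    and i: "\<And>T. T > 0 \<Longrightarrow> set_integrable lborel ({0..T} \<times> cell L) (\<lambda>(t, x). (norm (dU t x))\<^sup>2)"
    and ftc: "\<And>s t. 0 \<le> s \<Longrightarrow> s \<le> t \<Longrightarrow>
        AE x\<in>cell L in lborel. U t x - U s x = (LINT \<tau>:{s..t}|lborel. dU \<tau> x)"
    using U by (auto simp: has_time_derivative_def)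
  have "(\<lambda>y::real \<times> (real^3). (h, 0) + y) \<in> borel_measurable borel" by measurable
  from measurable_compose[OF this m]
  show "(\<lambda>(t, x). dU (h + t) x) \<in> borel_measurable borel"
    by (simp add: case_prod_unfold)
  fix T :: real assume T: "T > 0"
  \<comment> \<open>Translating space-time by \<open>(h, 0)\<close> turns the slab over
    \<open>{0..h+T}\<close> into the one over \<open>{-h..T}\<close>, which contains the slab over
    \<open>{0..T}\<close>.\<close>
  have "integrable lborel (\<lambda>y. indicator ({0..h+T} \<times> cell L) ((h, 0) + y) *\<^sub>R
      (case (h, 0) + y of (t, x) \<Rightarrow> (norm (dU t x))\<^sup>2))"
    using i[of "h + T"] T h unfolding set_integrable_def by (intro integrable_lborel_shift) auto
  then have "set_integrable lborel ({-h..T} \<times> cell L) (\<lambda>(t, x). (norm (dU (h + t) x))\<^sup>2)"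
    unfolding set_integrable_def
    by (rule Bochner_Integration.integrable_cong[OF refl, THEN iffD1, rotated])
       (auto simp: indicator_def split: prod.splits)
  then show "set_integrable lborel ({0..T} \<times> cell L) (\<lambda>(t, x). (norm (dU (h + t) x))\<^sup>2)"
  proof (rule set_integrable_subset)
    have "cell L \<in> sets lborel"
      unfolding cell_def by measurable
    then have "{0..T} \<times> cell L \<in> sets (borel \<Otimes>\<^sub>M borel)"
      by (intro pair_measureI) auto
    then show "{0..T} \<times> cell L \<in> sets lborel"
      by (simp only: borel_prod sets_lborel)
  qed (use h in auto)
next
  fix s t :: real assume st: "0 \<le> s \<and> s \<le> t"
  have "AE x\<in>cell L in lborel. U (h + t) x - U (h + s) x = (LINT \<tau>:{h+s..h+t}|lborel. dU \<tau> x)"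
    using st h U by (auto simp: has_time_derivative_def)
  moreover have "(LINT \<tau>:{h+s..h+t}|lborel. dU \<tau> x) = (LINT \<tau>:{s..t}|lborel. dU (h + \<tau>) x)" for x
    unfolding set_lebesgue_integral_def
    by (subst lborel_integral_real_affine[of 1 _ h])
       (auto simp: indicator_def intro!: Bochner_Integration.integral_cong)
  ultimately show "AE x\<in>cell L in lborel. U (h + t) x - U (h + s) x = (LINT \<tau>:{s..t}|lborel. dU (h + \<tau>) x)"
    by simp
qed

text \<open>Time does not occur explicitly in the equations and the sources are constant in time, so
  shifting the solution, its time derivative and the pressure together preserves every
  clause.\<close>

lemma strong_solution_shift:
  assumes U: "strong_solution L \<nu> f Gf Gb U0 U" and h: "0 \<le> h"
  shows "strong_solution L \<nu> f Gf Gb (U h) (\<lambda>t. U (h + t))"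
  unfolding strong_solution_def
proof (intro conjI allI impI)
  note sol = U[unfolded strong_solution_def]
  have W1: "U t \<in> W_space L 1" if "t \<ge> 0" for t
    using sol[THEN conjunct1] that by blast
  have cont: "((\<lambda>t. W_norm L 1 (U t - U s)) \<longlongrightarrow> 0) (at s within {0..})" if "s \<ge> 0" for s
    using sol[THEN conjunct2, THEN conjunct1] that by blast
  have W2: "AE t\<in>{0<..} in lborel. U t \<in> W_space L 2"
    by (rule sol[THEN conjunct2, THEN conjunct2, THEN conjunct1])
  have i: "(\<lambda>t. (W_norm L 2 (U t))\<^sup>2) absolutely_integrable_on {0..T}" if "T > 0" for T
    using sol[THEN conjunct2, THEN conjunct2, THEN conjunct2, THEN conjunct1] that by blast
  note eqs = sol[THEN conjunct2, THEN conjunct2, THEN conjunct2, THEN conjunct2, THEN conjunct2]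
  show "U (h + t) \<in> W_space L 1" if "t \<ge> 0" for t
    using W1 that h by simp
  show "((\<lambda>t. W_norm L 1 (U (h + t) - U (h + s))) \<longlongrightarrow> 0) (at s within {0..})" if "s \<ge> 0" for s
  proof -
    \<comment> \<open>For nonnegative \<open>h\<close> the shift keeps the half-line inside itself
      and sends punctured neighbourhoods of \<open>s\<close> to those of
      \<open>h + s\<close>.\<close>
    have "filterlim ((+) h) (at (h + s) within {0..}) (at s within {0..})"
      unfolding filterlim_at using h
      by (auto intro!: tendsto_intros simp: eventually_at_filter)
    then show ?thesis
      using h that by (intro filterlim_compose[OF cont]) auto
  qed
  show "AE t\<in>{0<..} in lborel. U (h + t) \<in> W_space L 2"
    using W2 h by (rule AE_greaterThan_shift)
  show "(\<lambda>t. (W_norm L 2 (U (h + t)))\<^sup>2) absolutely_integrable_on {0..T}" if "T > 0" for T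
  proof -
    have "(\<lambda>t. (W_norm L 2 (U t))\<^sup>2) absolutely_integrable_on {0..h+T}"
      using i h that by simp
    then have "(\<lambda>t. (W_norm L 2 (U t))\<^sup>2) absolutely_integrable_on {0+h..T+h}"
      by (rule set_integrable_subset) (use h in auto)
    then show ?thesis
      using integrable_on_shift_Icc_real[of "\<lambda>t. (W_norm L 2 (U t))\<^sup>2" h 0 T]
      by (simp add: absolutely_integrable_on_def o_def)
  qed
  show "AE x\<in>cell L in lborel. U (h + 0) x = U h x" by simp
  obtain dU p where dU: "has_time_derivative L U dU"
    and pde: "AE t\<in>{0<..} in lborel.
           (\<lambda>y. p t (horizontal y)) \<in> H_per L 1 \<and>
           (AE x\<in>cell L in lborel.
              momentum_equation L \<nu> f Gf (fst \<circ> dU t) (fst \<circ> U t) (snd \<circ> U t) (p t) x \<and>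
              buoyancy_equation L \<nu> Gb (snd \<circ> dU t) (fst \<circ> U t) (snd \<circ> U t) x)"
    using eqs by (elim exE conjE)
  show "\<exists>dU' p'. has_time_derivative L (\<lambda>t. U (h + t)) dU' \<and>
        (AE t\<in>{0<..} in lborel.
           (\<lambda>y. p' t (horizontal y)) \<in> H_per L 1 \<and>
           (AE x\<in>cell L in lborel.
              momentum_equation L \<nu> f Gf (fst \<circ> dU' t) (fst \<circ> U (h + t)) (snd \<circ> U (h + t)) (p' t) x \<and>
              buoyancy_equation L \<nu> Gb (snd \<circ> dU' t) (fst \<circ> U (h + t)) (snd \<circ> U (h + t)) x))"
    by (rule exI[of _ "\<lambda>t. dU (h + t)"], rule exI[of _ "\<lambda>t. p (h + t)"])
       (intro conjI has_time_derivative_shift[OF dU h] AE_greaterThan_shift[OF pde h])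
qed

section \<open>Iterating the squeezing estimate\<close>

text \<open>The step relates only times that are \<open>T\<close> apart, so the iteration starts
  from a bound on a whole window of length \<open>T\<close>. Each further window gains a factor
  \<open>q\<close> up to a small error from \<open>p\<close>.\<close>

lemma tendsto_0_of_contraction_step:
  fixes d p :: "real \<Rightarrow> real"
  assumes T: "T > 0" and q: "0 < q" "q < 1"
    and nonneg: "\<And>t. 0 \<le> d t"
    and step: "\<And>t. t \<ge> c \<Longrightarrow> d (t + T) \<le> q * d t + p (t + T)"
    and p: "(p \<longlongrightarrow> 0) at_top"
    and bdd: "\<And>a. a \<ge> c \<Longrightarrow> bounded (d ` {a..a + T})"
  shows "(d \<longlongrightarrow> 0) at_top"
proof (rule tendstoI)
  fix \<epsilon> :: real assume \<epsilon>: "\<epsilon> > 0"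
  define \<delta> where "\<delta> = \<epsilon> / 2"
  have \<delta>: "\<delta> > 0" using \<epsilon> by (simp add: \<delta>_def)
  \<comment> \<open>With this threshold \<delta> is the fixed point of the map \<open>r\<close> to
    \<open>q * r + \<delta> * (1 - q)\<close>, so the errors never accumulate beyond
    \<delta>.\<close>
  have "eventually (\<lambda>t. p t < \<delta> * (1 - q)) at_top"
    using p \<delta> q by (intro order_tendstoD(2)) auto
  then obtain t2 where t2: "\<And>t. t \<ge> t2 \<Longrightarrow> p t < \<delta> * (1 - q)"
    by (auto simp: eventually_at_top_linorder)
  define t1 where "t1 = max c t2"
  obtain M where M: "M > 0" "\<And>t. t \<in> {t1..t1+T} \<Longrightarrow> d t \<le> M"
    using bdd[of t1] unfolding bounded_pos by (auto simp: t1_def abs_le_iff)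
  have bound: "d t \<le> q ^ n * M + \<delta>" if "t1 + real n * T \<le> t" "t \<le> t1 + real (Suc n) * T" for n t
    using that
  proof (induction n arbitrary: t)
    case 0
    then show ?case using M(2)[of t] \<delta> by simp
  next
    case (Suc n)
    have "real n * T \<ge> 0" using T by simp
    moreover have "t1 + real n * T + T \<le> t" using Suc.prems(1) by (simp add: algebra_simps)
    ultimately have "t1 \<le> t - T" by linarith
    then have t: "t - T \<ge> c" "t \<ge> t2" using T by (auto simp: t1_def)
    have "d t \<le> q * d (t - T) + p t" using step[OF t(1)] by simp
    also have "\<dots> \<le> q * (q ^ n * M + \<delta>) + \<delta> * (1 - q)"
      using Suc q t2[OF t(2)] by (intro add_mono mult_left_mono Suc.IH) (auto simp: algebra_simps)
    finally show ?case by (simp add: algebra_simps)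
  qed
  have "(\<lambda>n. q ^ n * M) \<longlonglongrightarrow> 0 * M"
    using q by (intro tendsto_intros LIMSEQ_realpow_zero) auto
  then have "eventually (\<lambda>n. q ^ n * M < \<delta>) sequentially"
    using \<delta> by (intro order_tendstoD(2)) auto
  then obtain n0 where n0: "q ^ n0 * M < \<delta>"
    by (auto simp: eventually_sequentially)
  have "dist (d t) 0 < \<epsilon>" if t: "t \<ge> t1 + real n0 * T" for t
  proof -
    \<comment> \<open>The index of the window of length \<open>T\<close>, counted from
      \<open>t1\<close>, that contains \<open>t\<close>.\<close>
    define n where "n = nat \<lfloor>(t - t1) / T\<rfloor>"
    have ge: "real n0 \<le> (t - t1) / T" using t T by (simp add: field_simps)
    then have "n0 \<le> n" unfolding n_def by (simp add: le_nat_floor)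
    have "real n \<le> (t - t1) / T" "(t - t1) / T \<le> real (Suc n)"
      using ge unfolding n_def by linarith+
    then have "d t \<le> q ^ n * M + \<delta>"
      using T by (intro bound) (auto simp: field_simps)
    also have "\<dots> \<le> q ^ n0 * M + \<delta>"
      using \<open>n0 \<le> n\<close> q M(1) by (intro add_mono mult_right_mono power_decreasing) auto
    also have "\<dots> < \<epsilon>" using n0 by (simp add: \<delta>_def)
    finally show ?thesis using nonneg[of t] by simp
  qed
  then show "eventually (\<lambda>t. dist (d t) 0 < \<epsilon>) at_top"
    by (auto simp: eventually_at_top_linorder)
qed

section \<open>Trajectories of the dynamical system\<close>

lemma PE_dynamical_systemD:
  assumes S: "PE_dynamical_system L \<nu> f Gf Gb S" and U0: "U0 \<in> W_space L 1"
  shows "strong_solution L \<nu> f Gf Gb U0 (\<lambda>t. S t U0)"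
    and "\<And>U t. strong_solution L \<nu> f Gf Gb U0 U \<Longrightarrow> 0 \<le> t \<Longrightarrow> AE x\<in>cell L in lborel. U t x = S t U0 x"
  using S[unfolded PE_dynamical_system_def, THEN conjunct1] U0 by blast+

lemma strong_solution_W_space_1:
  assumes "strong_solution L \<nu> f Gf Gb U0 U" "0 \<le> t"
  shows "U t \<in> W_space L 1"
  using assms(1)[unfolded strong_solution_def, THEN conjunct1] assms(2) by blast

lemma strong_solution_continuous:
  assumes "strong_solution L \<nu> f Gf Gb U0 U" "0 \<le> s"
  shows "((\<lambda>t. W_norm L 1 (U t - U s)) \<longlongrightarrow> 0) (at s within {0..})"
  using assms(1)[unfolded strong_solution_def, THEN conjunct2, THEN conjunct1] assms(2) by blast

text \<open>Both sides, as functions of \<open>t\<close>, are strong solutions starting from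
  \<open>S h U0\<close>: the left one by translation in time. Uniqueness identifies them almost
  everywhere.\<close>

lemma PE_semigroup_AE:
  assumes S: "PE_dynamical_system L \<nu> f Gf Gb S" and U0: "U0 \<in> W_space L 1"
    and "0 \<le> h" "0 \<le> t"
  shows "AE x\<in>cell L in lborel. S (h + t) U0 x = S t (S h U0) x"
  using PE_dynamical_systemD(2)[OF S strong_solution_W_space_1[OF PE_dynamical_systemD(1)[OF S U0]]
      strong_solution_shift[OF PE_dynamical_systemD(1)[OF S U0]]] assms by blast

lemma continuous_on_W_norm_1_diff:
  assumes L: "\<forall>i. L$i > 0"
    and U: "strong_solution L \<nu> f Gf Gb U0 U" and W: "strong_solution L \<nu> f Gf Gb W0 W"
  shows "continuous_on {0..} (\<lambda>t. W_norm L 1 (U t - W t))"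
  unfolding continuous_on_def
proof
  fix s :: real assume s: "s \<in> {0..}"
  have H: "U t \<in> H1_states L" "W t \<in> H1_states L" if "0 \<le> t" for t
    using strong_solution_W_space_1[OF U that] strong_solution_W_space_1[OF W that] W_space_1_subset by auto
  have bound: "norm (W_norm L 1 (U t - W t) - W_norm L 1 (U s - W s)) \<le>
      W_norm L 1 (U t - U s) + W_norm L 1 (W t - W s)" if "0 \<le> t" for t
    unfolding real_norm_def using s that by (intro W_norm_1_diff_triangle[OF L] H) auto
  have "((\<lambda>t. W_norm L 1 (U t - W t) - W_norm L 1 (U s - W s)) \<longlongrightarrow> 0) (at s within {0..})"
  proof (rule Lim_null_comparison)
    show "eventually (\<lambda>t. norm (W_norm L 1 (U t - W t) - W_norm L 1 (U s - W s)) \<le>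
        W_norm L 1 (U t - U s) + W_norm L 1 (W t - W s)) (at s within {0..})"
      unfolding eventually_at_filter by (intro always_eventually allI impI bound) simp
    have "((\<lambda>t. W_norm L 1 (U t - U s) + W_norm L 1 (W t - W s)) \<longlongrightarrow> 0 + 0) (at s within {0..})"
      using s by (intro tendsto_add strong_solution_continuous[OF U] strong_solution_continuous[OF W]) auto
    then show "((\<lambda>t. W_norm L 1 (U t - U s) + W_norm L 1 (W t - W s)) \<longlongrightarrow> 0) (at s within {0..})"
      by simp
  qed
  then show "((\<lambda>t. W_norm L 1 (U t - W t)) \<longlongrightarrow> W_norm L 1 (U s - W s)) (at s within {0..})"
    by (rule LIM_zero_cancel)
qed

theorem corollary3p7:
  fixes L :: "real^3" and \<nu> f :: real
    and Gf :: "real^3 \<Rightarrow> real^2" and Gb :: "real^3 \<Rightarrow> real"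
    and S :: "real \<Rightarrow> pe_state \<Rightarrow> pe_state" and D :: "pe_state set"
    and e :: "nat \<Rightarrow> pe_state" and lam :: "nat \<Rightarrow> real"
    and N :: nat and R T q :: real
  assumes "\<forall>i. L $ i > 0" and "\<nu> > 0"
    and "Gf \<in> V_space L 1" and "Gb \<in> E_space L 1"
    and "wpartial L 3 Gf \<in> Lp_cell L 6" and "wpartial L 3 Gb \<in> Lp_cell L 6"
    and "PE_dynamical_system L \<nu> f Gf Gb S"
    and "eigenbasis L e lam"
    and "R > 0" and "absorbing L S (W2_ball L R)"
    and "D \<subseteq> W2_ball L R" and "forward_invariant S D" and "absorbing L S D"
    and "T > 0" and "0 < q" and "q < 1"
    and "\<forall>U\<in>D. \<forall>U'\<in>D.
           W_norm L 1 (Q_proj L e N (S T U - S T U')) \<le> q * W_norm L 1 (U - U')"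
  shows "determining_modes L S e N"
  unfolding determining_modes_def
proof (intro ballI impI)
  note L = assms(1) and S = assms(7)
  fix U U' assume U: "U \<in> W_space L 1" and U': "U' \<in> W_space L 1"
    and modes: "((\<lambda>t. W_norm L 1 (P_proj L e N (S t U - S t U'))) \<longlongrightarrow> 0) at_top"
  note sol = PE_dynamical_systemD(1)[OF S]
  have e: "e k \<in> H1_states L" for k
  proof -
    have "(e k, \<lambda>x. lam k *\<^sub>R e k x) \<in> form_operator L"
      using assms(8)[unfolded eigenbasis_def, THEN conjunct1] by blast
    then show ?thesis
      using W_space_1_subset by (auto simp only: form_operator_def mem_Collect_eq prod.case)
  qed
  have H: "S t V \<in> H1_states L" if "0 \<le> t" "V \<in> W_space L 1" for t V
    using strong_solution_W_space_1[OF sol[OF that(2)] that(1)] W_space_1_subset by blast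
  have "\<exists>r. \<forall>V\<in>{U, U'}. W_norm L 1 V \<le> r"
    by (rule exI[of _ "max (W_norm L 1 U) (W_norm L 1 U')"]) auto
  \<comment> \<open>The two initial states form a bounded set, so a single time serves for both
    trajectories to be in \<open>D\<close> from then on.\<close>
  then obtain t0 where t0: "t0 \<ge> 0" and D: "\<And>t. t \<ge> t0 \<Longrightarrow> S t ` {U, U'} \<subseteq> D"
    using assms(13)[unfolded absorbing_def, rule_format, of "{U, U'}"] U U' by auto
  define p where "p t = W_norm L 1 (P_proj L e N (S t U - S t U'))" for t
  show "((\<lambda>t. W_norm L 1 (S t U - S t U')) \<longlongrightarrow> 0) at_top"
  proof (rule tendsto_0_of_contraction_step[OF assms(14-16), where p = p and c = t0])
    show "(p \<longlongrightarrow> 0) at_top" using modes unfolding p_def .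
    show "0 \<le> W_norm L 1 (S t U - S t U')" for t by (simp add: W_norm_def)
    show "bounded ((\<lambda>t. W_norm L 1 (S t U - S t U')) ` {a..a + T})" if "a \<ge> t0" for a
      using that t0
      by (intro compact_imp_bounded compact_continuous_image
          continuous_on_subset[OF continuous_on_W_norm_1_diff[OF L sol[OF U] sol[OF U']]]) auto
    fix t assume t: "t \<ge> t0"
    have t': "t \<ge> 0" and T: "T \<ge> 0" using t t0 assms(14) by auto
    \<comment> \<open>\<open>?X\<close> is the difference that has to be bounded; \<open>?Y\<close>
      restarts both trajectories at time \<open>t\<close>, the form to which the squeezing estimate
      on \<open>D\<close> applies. They agree almost everywhere.\<close>
    let ?X = "S (t + T) U - S (t + T) U'" and ?Y = "S T (S t U) - S T (S t U')"
    have Wt: "S t U \<in> W_space L 1" "S t U' \<in> W_space L 1"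
      by (rule strong_solution_W_space_1[OF sol[OF U] t'] strong_solution_W_space_1[OF sol[OF U'] t'])+
    have X: "?X \<in> H1_states L" using U U' t' T by (intro H1_states_diff H) auto
    have Y: "?Y \<in> H1_states L" using Wt T by (intro H1_states_diff H) auto
    have XY: "AE x\<in>cell L in lborel. ?X x = ?Y x"
      using PE_semigroup_AE[OF S U t' T] PE_semigroup_AE[OF S U' t' T] by eventually_elim auto
    have P: "P_proj L e N ?Y \<in> H1_states L" using e Y by (intro P_proj_H1_states) auto
    have "?Y = (\<lambda>x. Q_proj L e N ?Y x + P_proj L e N ?Y x)"
      by (auto simp: Q_proj_def)
    then have 1: "W_norm L 1 ?Y \<le> W_norm L 1 (Q_proj L e N ?Y) + W_norm L 1 (P_proj L e N ?Y)"
      using W_norm_1_triangle[OF L, of "Q_proj L e N ?Y" "P_proj L e N ?Y"] P H1_states_diff[OF Y P]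
      by (simp add: Q_proj_def)
    have 2: "W_norm L 1 (Q_proj L e N ?Y) \<le> q * W_norm L 1 (S t U - S t U')"
      using D[OF t] by (intro assms(17)[rule_format]) auto
    \<comment> \<open>The projections of \<open>?X\<close> and \<open>?Y\<close> coincide, so the
      modes of the restarted difference are those assumed to decay.\<close>
    have 3: "W_norm L 1 (P_proj L e N ?Y) = p (t + T)"
      unfolding p_def P_proj_cong_AE[where e = e and N = N, OF e X Y XY] ..
    show "W_norm L 1 ?X \<le> q * W_norm L 1 (S t U - S t U') + p (t + T)"
      unfolding W_norm_1_cong_AE[OF X Y XY] using 1 2 3 by linarith
  qed
qed

end
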